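(* For every integer $r\ge 3$ there exist constants $c_0,\delta_0>0$ such that for every $0<\delta\le\delta_0$ the following holds for all sufficiently large $n$: every $r$-graph $H$ on $n$ vertices with $\Delta_{r-1}(H)\le \delta n$ satisfies \[ \alpha(H)\;\ge\; c_0\left(\frac{1}{\delta}\ln\frac{1}{\delta}\right)^{1/(r-1)}. \]
   Context: An $r$-graph $H$ is a vertex set $V(H)$ with a family $E(H)$ of $r$-element subsets (edges). $\Delta_{r-1}(H)$ is the maximum, over all $(r-1)$-subsets $S$ of $V(H)$, of the number of edges of $H$ containing $S$. The independence number $\alpha(H)$ is the largest size of a set of vertices of $H$ containing no edge of $H$. *)

theory Defs
  imports Complex_Main "HOL-Library.Ramsey"
begin

text \<open>
  \<^term>\<open>nsets V r\<close> is the set of finite \<open>r\<close>-element subsets of \<open>V\<close>. A hypergraph is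
  given by its vertex set \<open>V\<close>, which is assumed finite, and its edge set \<open>E\<close>.
\<close>

definition r_graph :: "nat \<Rightarrow> 'a set \<Rightarrow> 'a set set \<Rightarrow> bool" where
  "r_graph r V E \<longleftrightarrow> finite V \<and> E \<subseteq> nsets V r"

definition codegree :: "'a set set \<Rightarrow> 'a set \<Rightarrow> nat" where
  "codegree E S = card {e \<in> E. S \<subseteq> e}"

text \<open>The maximum ranges over a nonempty set exactly when \<open>r - 1 \<le> card V\<close>.\<close>

definition max_codegree :: "nat \<Rightarrow> 'a set \<Rightarrow> 'a set set \<Rightarrow> nat" where
  "max_codegree r V E = Max (codegree E ` nsets V (r - 1))"

definition independent_set :: "'a set \<Rightarrow> 'a set set \<Rightarrow> 'a set \<Rightarrow> bool" where
  "independent_set V E I \<longleftrightarrow> I \<subseteq> V \<and> (\<forall>e\<in>E. \<not> e \<subseteq> I)"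

definition independence_number :: "'a set \<Rightarrow> 'a set set \<Rightarrow> nat" where
  "independence_number V E = Max (card ` {I. independent_set V E I})"

end

theory Submission
  imports Defs "HOL-Library.Disjoint_Sets"
begin

text \<open>
  Let \<open>D\<close> be a small negative power of \<open>\<delta>\<close> and choose \<open>m\<close> such that \<open>\<delta> * m ^ (r - 1)\<close> is of order
  \<open>D\<close>. Since \<open>D ^ 4\<close> is much smaller than \<open>m\<close>, a random set of about \<open>m\<close> vertices contains few
  cycles of length 2, 3 or 4 in the hypergraph. Deleting a vertex from
  each of them, and the vertices of large degree, leaves at least \<open>m / 2\<close> vertices that span an
  \<open>r\<close>-graph of maximum degree at most \<open>D\<close> in which any two edges share at most one vertex and
  there are no cycles of length 3 or 4. For such a hypergraph the semirandom method of Ajtai, Komlos,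
  Pintz, Spencer and Szemeredi gives an independent set of order \<open>m * (ln D / D) powr (1 / (r - 1))\<close>,
  which is of order \<open>(ln D / \<delta>) powr (1 / (r - 1))\<close>, and \<open>ln D\<close> is of order \<open>ln (1 / \<delta>)\<close>.

  In a round of the semirandom method a random sparse set \<open>C\<close> is chosen, and a vertex survives if no
  edge through it has all its other vertices in \<open>C\<close>. The survivors in \<open>C\<close> join the independent set,
  and each remaining edge is replaced by its trace on the survivors outside \<open>C\<close>. Extra coin flips
  give every vertex the same survival probability \<open>q\<close>. By the absence of short cycles the
  contributions of the edges at a vertex to its new degrees are independent, so Chebyshev's
  inequality controls all but a few vertices, which are discarded. Only upper bounds on degrees are
  ever needed. The numbers of vertices need no concentration: a round only has to gain in
  expectation for the functional that adds the independent vertices gained so far to \<open>g\<close> times the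
  number of vertices left, where \<open>g\<close> is the yield per vertex of the rounds still to come.
\<close>

section \<open>Expectation over a random subset\<close>

text \<open>The expectation of \<open>F Z\<close> when \<open>Z\<close> contains each \<open>z \<in> U\<close> independently with probability \<open>\<pi> z\<close>.\<close>

definition bexp :: "'b set \<Rightarrow> ('b \<Rightarrow> real) \<Rightarrow> ('b set \<Rightarrow> real) \<Rightarrow> real" where
  "bexp U \<pi> F = (\<Sum>Z\<in>Pow U. (\<Prod>z\<in>Z. \<pi> z) * (\<Prod>z\<in>U - Z. 1 - \<pi> z) * F Z)"

definition depends_on :: "('b set \<Rightarrow> 'c) \<Rightarrow> 'b set \<Rightarrow> bool" where
  "depends_on F B \<longleftrightarrow> (\<forall>Z. F Z = F (Z \<inter> B))"

lemma bexp_empty [simp]: "bexp {} \<pi> F = F {}"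
  by (simp add: bexp_def)

lemma bexp_insert:
  assumes "finite U" "a \<notin> U"
  shows "bexp (insert a U) \<pi> F = \<pi> a * bexp U \<pi> (\<lambda>Z. F (insert a Z)) + (1 - \<pi> a) * bexp U \<pi> F"
proof -
  have fin: "finite (Pow U)" and dis: "Pow U \<inter> insert a ` Pow U = {}"
    using assms by auto
  have inj: "inj_on (insert a) (Pow U)"
  proof (rule inj_onI)
    fix X Y assume "X \<in> Pow U" "Y \<in> Pow U" "insert a X = insert a Y"
    then show "X = Y" using insert_ident[of a X Y] assms(2) by auto
  qed
  let ?h = "\<lambda>Z. (\<Prod>z\<in>Z. \<pi> z) * (\<Prod>z\<in>insert a U - Z. 1 - \<pi> z) * F Z"
  have "bexp (insert a U) \<pi> F = sum ?h (Pow U) + sum ?h (insert a ` Pow U)"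
    by (simp only: bexp_def Pow_insert sum.union_disjoint[OF fin finite_imageI[OF fin] dis])
  also have "sum ?h (Pow U) = (1 - \<pi> a) * bexp U \<pi> F"
    unfolding bexp_def sum_distrib_left
  proof (rule sum.cong[OF refl])
    fix Z assume "Z \<in> Pow U"
    then have "insert a U - Z = insert a (U - Z)" "a \<notin> U - Z" "finite (U - Z)"
      using assms by auto
    then show "?h Z = (1 - \<pi> a) * ((\<Prod>z\<in>Z. \<pi> z) * (\<Prod>z\<in>U - Z. 1 - \<pi> z) * F Z)"
      by simp
  qed
  also have "sum ?h (insert a ` Pow U) = \<pi> a * bexp U \<pi> (\<lambda>Z. F (insert a Z))"
    unfolding bexp_def sum_distrib_left sum.reindex[OF inj] o_def
  proof (rule sum.cong[OF refl])
    fix Z assume "Z \<in> Pow U"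
    then have "insert a U - insert a Z = U - Z" "a \<notin> Z" "finite Z"
      using assms by (auto intro: finite_subset)
    then show "?h (insert a Z) = \<pi> a * ((\<Prod>z\<in>Z. \<pi> z) * (\<Prod>z\<in>U - Z. 1 - \<pi> z) * F (insert a Z))"
      by simp
  qed
  finally show ?thesis by simp
qed

lemma bexp_add: "bexp U \<pi> (\<lambda>Z. F Z + G Z) = bexp U \<pi> F + bexp U \<pi> G"
  by (simp add: bexp_def algebra_simps sum.distrib)

lemma bexp_cmult: "bexp U \<pi> (\<lambda>Z. c * F Z) = c * bexp U \<pi> F"
  by (simp add: bexp_def sum_distrib_left mult_ac)

lemma bexp_diff: "bexp U \<pi> (\<lambda>Z. F Z - G Z) = bexp U \<pi> F - bexp U \<pi> G"
  by (simp add: bexp_def algebra_simps sum_subtractf)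

lemma bexp_const:
  assumes "finite U"
  shows "bexp U \<pi> (\<lambda>Z. c) = c"
  using assms by (induction U) (auto simp: bexp_insert algebra_simps)

lemma bexp_sum: "bexp U \<pi> (\<lambda>Z. \<Sum>i\<in>S. F i Z) = (\<Sum>i\<in>S. bexp U \<pi> (F i))"
  unfolding bexp_def by (subst sum.swap) (simp add: sum_distrib_left)

lemma bexp_mono:
  assumes "\<And>z. z \<in> U \<Longrightarrow> 0 \<le> \<pi> z \<and> \<pi> z \<le> 1" and "\<And>Z. Z \<subseteq> U \<Longrightarrow> F Z \<le> G Z"
  shows "bexp U \<pi> F \<le> bexp U \<pi> G"
  unfolding bexp_def
proof (rule sum_mono)
  fix Z assume Z: "Z \<in> Pow U"
  have "0 \<le> (\<Prod>z\<in>Z. \<pi> z) * (\<Prod>z\<in>U - Z. 1 - \<pi> z)"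
    using assms(1) Z by (intro mult_nonneg_nonneg prod_nonneg) auto
  then show "(\<Prod>z\<in>Z. \<pi> z) * (\<Prod>z\<in>U - Z. 1 - \<pi> z) * F Z
      \<le> (\<Prod>z\<in>Z. \<pi> z) * (\<Prod>z\<in>U - Z. 1 - \<pi> z) * G Z"
    using assms(2) Z by (intro mult_left_mono) auto
qed

lemma bexp_nonneg:
  assumes "\<And>z. z \<in> U \<Longrightarrow> 0 \<le> \<pi> z \<and> \<pi> z \<le> 1" and "\<And>Z. 0 \<le> F Z"
  shows "0 \<le> bexp U \<pi> F"
proof -
  have "bexp U \<pi> (\<lambda>_. 0) \<le> bexp U \<pi> F" using assms by (intro bexp_mono) auto
  then show ?thesis by (simp add: bexp_def)
qed

text \<open>A finite average is at most the maximum. This turns an expectation into a good outcome,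
  once for the initial sample and once in every round.\<close>

lemma bexp_attained:
  assumes "finite U" "\<And>z. z \<in> U \<Longrightarrow> 0 \<le> \<pi> z \<and> \<pi> z \<le> 1"
  obtains Z where "Z \<subseteq> U" "bexp U \<pi> F \<le> F Z"
proof -
  have fin: "finite (F ` Pow U)" using assms(1) by auto
  have "Max (F ` Pow U) \<in> F ` Pow U" using fin by (intro Max_in) auto
  then obtain Z where Z: "Z \<subseteq> U" "F Z = Max (F ` Pow U)" by auto
  have "bexp U \<pi> F \<le> bexp U \<pi> (\<lambda>_. F Z)"
    using Z fin assms by (intro bexp_mono) auto
  then show ?thesis using that Z bexp_const[OF assms(1)] by metis
qed

section \<open>Independence of functions of disjoint coordinates\<close>

lemma depends_on_mono:
  assumes "depends_on F B" "B \<subseteq> B'" shows "depends_on F B'"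
  unfolding depends_on_def
proof
  fix Z
  have "Z \<inter> B' \<inter> B = Z \<inter> B" using assms(2) by auto
  then show "F Z = F (Z \<inter> B')" using assms(1) unfolding depends_on_def by metis
qed

lemma depends_on_of_bool: "depends_on P B \<Longrightarrow> depends_on (\<lambda>Z. of_bool (P Z) :: real) B"
  unfolding depends_on_def by (intro allI arg_cong[where f = of_bool]) (elim allE)

text \<open>Induction on the ground set, exposing one element \<open>a\<close>. Since
  \<open>B\<close> and \<open>B'\<close> are disjoint, one of the two functions ignores
  \<open>a\<close>, so it is the same in both terms of the expansion and factors out.\<close>

lemma bexp_mult_indep:
  assumes "finite U" "B \<inter> B' = {}" "depends_on F B" "depends_on G B'"
  shows "bexp U \<pi> (\<lambda>Z. F Z * G Z) = bexp U \<pi> F * bexp U \<pi> G"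
  using assms(1,3,4)
proof (induction U arbitrary: F G)
  case empty
  then show ?case by simp
next
  case (insert a U)
  have ins: "depends_on (\<lambda>Z. H (insert a Z)) C" if "depends_on H C" for H :: "'a set \<Rightarrow> real" and C
    unfolding depends_on_def
  proof
    fix Z
    have "insert a (Z \<inter> C) \<inter> C = insert a Z \<inter> C" by auto
    then show "H (insert a Z) = H (insert a (Z \<inter> C))" using that unfolding depends_on_def by metis
  qed
  have noop: "(\<lambda>Z. H (insert a Z)) = H" if "depends_on H C" "a \<notin> C" for H :: "'a set \<Rightarrow> real" and C
  proof
    fix Z
    have "insert a Z \<inter> C = Z \<inter> C" using that(2) by auto
    then show "H (insert a Z) = H Z" using that(1) unfolding depends_on_def by metis
  qed
  note IH = insert.IH[OF insert.prems]
    insert.IH[OF ins[OF insert.prems(1)] insert.prems(2)]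
    insert.IH[OF insert.prems(1) ins[OF insert.prems(2)]]
  consider "a \<notin> B" | "a \<notin> B'" using assms(2) by auto
  then show ?case
  proof cases
    case 1
    show ?thesis
      using insert.hyps IH noop[OF insert.prems(1) 1] by (simp add: bexp_insert fun_eq_iff algebra_simps)
  next
    case 2
    show ?thesis
      using insert.hyps IH noop[OF insert.prems(2) 2] by (simp add: bexp_insert fun_eq_iff algebra_simps)
  qed
qed

lemma depends_on_prod:
  assumes "\<And>i. i \<in> S \<Longrightarrow> depends_on (F i) (B i)"
  shows "depends_on (\<lambda>Z. \<Prod>i\<in>S. F i Z :: real) (\<Union>i\<in>S. B i)"
proof -
  have "depends_on (F i) (\<Union>i\<in>S. B i)" if "i \<in> S" for i
    using assms[OF that] by (rule depends_on_mono) (use that in auto)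
  then show ?thesis unfolding depends_on_def by (intro allI prod.cong refl) metis
qed

lemma bexp_prod_indep:
  assumes "finite U" "finite S" "disjoint_family_on B S"
    and "\<And>i. i \<in> S \<Longrightarrow> depends_on (F i) (B i)"
  shows "bexp U \<pi> (\<lambda>Z. \<Prod>i\<in>S. F i Z) = (\<Prod>i\<in>S. bexp U \<pi> (F i))"
  using assms(2-)
proof (induction S)
  case empty
  then show ?case using bexp_const[OF assms(1)] by simp
next
  case (insert i S)
  have "bexp U \<pi> (\<lambda>Z. F i Z * (\<Prod>i\<in>S. F i Z)) = bexp U \<pi> (F i) * bexp U \<pi> (\<lambda>Z. \<Prod>i\<in>S. F i Z)"
  proof (rule bexp_mult_indep[OF assms(1), where B = "B i" and B' = "\<Union>i\<in>S. B i"])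
    show "B i \<inter> (\<Union>i\<in>S. B i) = {}"
      using insert.prems(1) insert.hyps unfolding disjoint_family_on_def by auto
    show "depends_on (F i) (B i)" using insert.prems by simp
    show "depends_on (\<lambda>Z. \<Prod>i\<in>S. F i Z) (\<Union>i\<in>S. B i)"
      using insert.prems by (intro depends_on_prod) auto
  qed
  also have "bexp U \<pi> (\<lambda>Z. \<Prod>i\<in>S. F i Z) = (\<Prod>i\<in>S. bexp U \<pi> (F i))"
  proof (rule insert.IH)
    show "disjoint_family_on B S"
      using insert.prems(1) by (rule disjoint_family_on_mono[OF subset_insertI])
    show "depends_on (F j) (B j)" if "j \<in> S" for j
      using insert.prems(2) that by simp
  qed
  finally show ?case using insert.hyps by simp
qed

lemma bexp_subset:
  assumes "finite U" "S \<subseteq> U"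
  shows "bexp U \<pi> (\<lambda>Z. of_bool (S \<subseteq> Z)) = (\<Prod>z\<in>S. \<pi> z)"
proof -
  have single: "bexp U \<pi> (\<lambda>Z. of_bool (z \<in> Z)) = \<pi> z" if "z \<in> U" for z
  proof -
    have fin: "finite (U - {z})" and z: "z \<notin> U - {z}" using assms(1) by auto
    have U: "U = insert z (U - {z})" using that by auto
    have "bexp (U - {z}) \<pi> (\<lambda>Z. of_bool (z \<in> Z)) = bexp (U - {z}) \<pi> (\<lambda>Z. 0)"
      unfolding bexp_def by (intro sum.cong) auto
    then show ?thesis
      by (subst U, subst bexp_insert[OF fin z]) (simp add: bexp_const[OF fin])
  qed
  have finS: "finite S" using assms finite_subset by auto
  have eq: "(\<lambda>Z. of_bool (S \<subseteq> Z)) = (\<lambda>Z. \<Prod>z\<in>S. of_bool (z \<in> Z) :: real)"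
  proof
    fix Z
    show "of_bool (S \<subseteq> Z) = (\<Prod>z\<in>S. of_bool (z \<in> Z) :: real)"
      using finS by (cases "S \<subseteq> Z") (auto intro!: prod.neutral simp: subset_iff)
  qed
  have "bexp U \<pi> (\<lambda>Z. of_bool (S \<subseteq> Z)) = (\<Prod>z\<in>S. bexp U \<pi> (\<lambda>Z. of_bool (z \<in> Z)))"
    unfolding eq by (rule bexp_prod_indep[OF assms(1) finS, where B = "\<lambda>z. {z}"])
      (auto simp: disjoint_family_on_def depends_on_def)
  also have "\<dots> = (\<Prod>z\<in>S. \<pi> z)" using single assms(2) by (intro prod.cong) auto
  finally show ?thesis .
qed

text \<open>The variance of a sum of pairwise independent indicators is at most its mean, hence at
  most \<open>M\<close>, and a value above \<open>K\<close> deviates from the mean by at least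
  \<open>K - M\<close>.\<close>

lemma bexp_chebyshev:
  fixes X :: "'i \<Rightarrow> 'b set \<Rightarrow> bool"
  assumes fin: "finite U" and \<pi>: "\<And>z. z \<in> U \<Longrightarrow> 0 \<le> \<pi> z \<and> \<pi> z \<le> 1"
    and S: "finite S"
    and indep: "\<And>f g. f \<in> S \<Longrightarrow> g \<in> S \<Longrightarrow> f \<noteq> g \<Longrightarrow>
      bexp U \<pi> (\<lambda>Z. of_bool (X f Z) * of_bool (X g Z))
        = bexp U \<pi> (\<lambda>Z. of_bool (X f Z)) * bexp U \<pi> (\<lambda>Z. of_bool (X g Z))"
    and M: "(\<Sum>f\<in>S. bexp U \<pi> (\<lambda>Z. of_bool (X f Z))) \<le> M" and "M < K"
  shows "bexp U \<pi> (\<lambda>Z. of_bool (K < (\<Sum>f\<in>S. of_bool (X f Z)))) \<le> M / (K - M)\<^sup>2"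
proof -
  define e where "e f = bexp U \<pi> (\<lambda>Z. of_bool (X f Z))" for f
  define Y where "Y Z = (\<Sum>f\<in>S. of_bool (X f Z) :: real)" for Z
  define \<mu> where "\<mu> = sum e S"
  have EY: "bexp U \<pi> Y = \<mu>" unfolding Y_def \<mu>_def e_def by (rule bexp_sum)
  have "bexp U \<pi> (\<lambda>Z. (Y Z)\<^sup>2) = (\<Sum>f\<in>S. \<Sum>g\<in>S. bexp U \<pi> (\<lambda>Z. of_bool (X f Z) * of_bool (X g Z)))"
    unfolding Y_def power2_eq_square sum_product by (simp only: bexp_sum)
  \<comment> \<open>On the diagonal the value is \<open>e f\<close>; adding \<open>e f * e f\<close>
    there lets the double sum factor into \<open>\<mu>\<^sup>2\<close>.\<close>
  also have "\<dots> \<le> (\<Sum>f\<in>S. \<Sum>g\<in>S. e f * e g + (if f = g then e f else 0))"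
  proof (intro sum_mono)
    fix f g assume fg: "f \<in> S" "g \<in> S"
    show "bexp U \<pi> (\<lambda>Z. of_bool (X f Z) * of_bool (X g Z)) \<le> e f * e g + (if f = g then e f else 0)"
    proof (cases "f = g")
      case True
      then have "(\<lambda>Z. of_bool (X f Z) * of_bool (X g Z)) = (\<lambda>Z. of_bool (X f Z) :: real)"
        by (auto simp: fun_eq_iff)
      then show ?thesis using True by (simp add: e_def)
    next
      case False
      then show ?thesis using indep[OF fg False] by (simp add: e_def)
    qed
  qed
  also have "\<dots> = \<mu>\<^sup>2 + \<mu>"
    using S by (simp add: sum.distrib power2_eq_square \<mu>_def sum_product)
  finally have EY2: "bexp U \<pi> (\<lambda>Z. (Y Z)\<^sup>2) \<le> \<mu>\<^sup>2 + \<mu>" .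
  have "bexp U \<pi> (\<lambda>Z. (K - M)\<^sup>2 * of_bool (K < Y Z)) \<le> bexp U \<pi> (\<lambda>Z. (Y Z - \<mu>)\<^sup>2)"
  proof (rule bexp_mono[OF \<pi>])
    fix Z assume "Z \<subseteq> U"
    show "(K - M)\<^sup>2 * of_bool (K < Y Z) \<le> (Y Z - \<mu>)\<^sup>2"
    proof (cases "K < Y Z")
      case True
      then have "K - M \<le> Y Z - \<mu>" using M \<mu>_def e_def by auto
      then show ?thesis using True \<open>M < K\<close> by (auto intro: power_mono)
    qed auto
  qed
  also have "bexp U \<pi> (\<lambda>Z. (Y Z - \<mu>)\<^sup>2) = bexp U \<pi> (\<lambda>Z. ((Y Z)\<^sup>2 - 2 * \<mu> * Y Z) + \<mu>\<^sup>2)"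
    by (simp add: power2_eq_square algebra_simps)
  also have "\<dots> = bexp U \<pi> (\<lambda>Z. (Y Z)\<^sup>2) - 2 * \<mu> * \<mu> + \<mu>\<^sup>2"
    by (simp only: bexp_add bexp_diff bexp_cmult bexp_const[OF fin] EY)
  also have "\<dots> \<le> M" using EY2 M unfolding \<mu>_def e_def by (simp add: power2_eq_square)
  finally have "(K - M)\<^sup>2 * bexp U \<pi> (\<lambda>Z. of_bool (K < Y Z)) \<le> M" by (simp add: bexp_cmult)
  then show ?thesis using \<open>M < K\<close> unfolding Y_def by (simp add: field_simps)
qed

section \<open>One round of the nibble\<close>

text \<open>Girth at least five in the sense of Berge cycles: the conjuncts exclude cycles of length
  2, 3 and 4, each given by distinct edges and distinct connecting vertices.\<close>

definition short_cycle_free :: "'a set set \<Rightarrow> bool" where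
  "short_cycle_free E \<longleftrightarrow>
    (\<forall>e\<in>E. \<forall>f\<in>E. \<forall>x y. e \<noteq> f \<longrightarrow> x \<in> e \<inter> f \<longrightarrow> y \<in> e \<inter> f \<longrightarrow> x = y) \<and>
    (\<forall>e\<in>E. \<forall>f\<in>E. \<forall>g\<in>E. \<forall>x y z. distinct [e, f, g] \<longrightarrow> distinct [x, y, z] \<longrightarrow>
      \<not> (x \<in> e \<inter> f \<and> y \<in> f \<inter> g \<and> z \<in> g \<inter> e)) \<and>
    (\<forall>e\<in>E. \<forall>f\<in>E. \<forall>g\<in>E. \<forall>h\<in>E. \<forall>x y z w. distinct [e, f, g, h] \<longrightarrow> distinct [x, y, z, w] \<longrightarrow>
      \<not> (x \<in> e \<inter> f \<and> y \<in> f \<inter> g \<and> z \<in> g \<inter> h \<and> w \<in> h \<inter> e))"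

lemma short_cycle_free_linear:
  assumes "short_cycle_free E" "e \<in> E" "f \<in> E" "x \<in> e" "x \<in> f" "y \<in> e" "y \<in> f" "e \<noteq> f"
  shows "x = y"
  using assms unfolding short_cycle_free_def by blast

lemma short_cycle_free_no_3cycle:
  assumes E: "short_cycle_free E" "e \<in> E" "f \<in> E" "g \<in> E"
    and d: "e \<noteq> f" "f \<noteq> g" "e \<noteq> g" "x \<noteq> y" "y \<noteq> z" "x \<noteq> z"
    and i: "x \<in> e" "x \<in> f" "y \<in> f" "y \<in> g" "z \<in> g" "z \<in> e"
  shows False
proof -
  have "\<forall>e\<in>E. \<forall>f\<in>E. \<forall>g\<in>E. \<forall>x y z. distinct [e, f, g] \<longrightarrow> distinct [x, y, z] \<longrightarrow>
      \<not> (x \<in> e \<inter> f \<and> y \<in> f \<inter> g \<and> z \<in> g \<inter> e)"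
    using E(1) unfolding short_cycle_free_def by (elim conjE)
  from this[rule_format, OF E(2-4), of x y z] d i show False by simp
qed

lemma short_cycle_free_no_4cycle:
  assumes E: "short_cycle_free E" "e \<in> E" "f \<in> E" "g \<in> E" "h \<in> E"
    and d: "distinct [e, f, g, h]" "distinct [x, y, z, w]"
    and i: "x \<in> e" "x \<in> f" "y \<in> f" "y \<in> g" "z \<in> g" "z \<in> h" "w \<in> h" "w \<in> e"
  shows False
proof -
  have "\<forall>e\<in>E. \<forall>f\<in>E. \<forall>g\<in>E. \<forall>h\<in>E. \<forall>x y z w. distinct [e, f, g, h] \<longrightarrow> distinct [x, y, z, w] \<longrightarrow>
      \<not> (x \<in> e \<inter> f \<and> y \<in> f \<inter> g \<and> z \<in> g \<inter> h \<and> w \<in> h \<inter> e)"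
    using E(1) unfolding short_cycle_free_def by (elim conjE)
  from this[rule_format, OF E(2-5) d] i show False by simp
qed

text \<open>All new edges come from one map \<open>\<phi>\<close>, so distinct new edges have
  distinct originals, and a short cycle lifts to \<open>E\<close> with the same connecting
  vertices.\<close>

lemma short_cycle_free_shrink:
  fixes E E' :: "'a set set" and \<phi> :: "'a set \<Rightarrow> 'a set"
  assumes E: "short_cycle_free E" and E': "\<And>e'. e' \<in> E' \<Longrightarrow> \<exists>e\<in>E. e' = \<phi> e \<and> \<phi> e \<subseteq> e"
  shows "short_cycle_free E'"
  unfolding short_cycle_free_def
proof (intro conjI ballI allI impI)
  fix e f :: "'a set" and x y :: 'a assume "e \<in> E'" "f \<in> E'" and a: "e \<noteq> f" "x \<in> e \<inter> f" "y \<in> e \<inter> f"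
  then obtain e0 f0 where o: "e0 \<in> E" "e = \<phi> e0" "\<phi> e0 \<subseteq> e0" "f0 \<in> E" "f = \<phi> f0" "\<phi> f0 \<subseteq> f0"
    using E' by metis
  show "x = y" by (rule short_cycle_free_linear[OF E o(1,4)]) (use a o in auto)
next
  fix e f g :: "'a set" and x y z :: 'a
  assume "e \<in> E'" "f \<in> E'" "g \<in> E'" and a: "distinct [e, f, g]" "distinct [x, y, z]"
  then obtain e0 f0 g0 where o: "e0 \<in> E" "f0 \<in> E" "g0 \<in> E"
      "e = \<phi> e0" "f = \<phi> f0" "g = \<phi> g0" "\<phi> e0 \<subseteq> e0" "\<phi> f0 \<subseteq> f0" "\<phi> g0 \<subseteq> g0"
    using E' by metis
  show "\<not> (x \<in> e \<inter> f \<and> y \<in> f \<inter> g \<and> z \<in> g \<inter> e)"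
  proof
    assume b: "x \<in> e \<inter> f \<and> y \<in> f \<inter> g \<and> z \<in> g \<inter> e"
    show False by (rule short_cycle_free_no_3cycle[OF E o(1-3), of x y z]) (use a b o in auto)
  qed
next
  fix e f g h :: "'a set" and x y z w :: 'a
  assume "e \<in> E'" "f \<in> E'" "g \<in> E'" "h \<in> E'" and a: "distinct [e, f, g, h]" "distinct [x, y, z, w]"
  then obtain e0 f0 g0 h0 where o: "e0 \<in> E" "f0 \<in> E" "g0 \<in> E" "h0 \<in> E"
      "e = \<phi> e0" "f = \<phi> f0" "g = \<phi> g0" "h = \<phi> h0"
      "\<phi> e0 \<subseteq> e0" "\<phi> f0 \<subseteq> f0" "\<phi> g0 \<subseteq> g0" "\<phi> h0 \<subseteq> h0"
    using E' by metis
  show "\<not> (x \<in> e \<inter> f \<and> y \<in> f \<inter> g \<and> z \<in> g \<inter> h \<and> w \<in> h \<inter> e)"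
  proof
    assume b: "x \<in> e \<inter> f \<and> y \<in> f \<inter> g \<and> z \<in> g \<inter> h \<and> w \<in> h \<inter> e"
    have "distinct [e0, f0, g0, h0]" using a(1) unfolding o(5-8) by auto
    moreover have "x \<in> e0" "x \<in> f0" "y \<in> f0" "y \<in> g0" "z \<in> g0" "z \<in> h0" "w \<in> h0" "w \<in> e0"
      using b o(9-12) unfolding o(5-8) by blast+
    ultimately show False using short_cycle_free_no_4cycle[OF E o(1-4) _ a(2)] by blast
  qed
qed

text \<open>Edges of all sizes from 2 to \<open>r\<close> occur because later rounds work with
  traces. The last assumption says that the survival probability before the coin flips, a product
  because the edges at \<open>u\<close> meet only in \<open>u\<close>, is at least \<open>q\<close>,
  so that the coins can lower it to \<open>q\<close>.\<close>

locale nibble =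
  fixes A :: "'a set" and E :: "'a set set" and r :: nat and p q :: real
  assumes finite_A: "finite A" and E_sub: "\<And>f. f \<in> E \<Longrightarrow> f \<subseteq> A"
    and E_card: "\<And>f. f \<in> E \<Longrightarrow> 2 \<le> card f \<and> card f \<le> r"
    and scf: "short_cycle_free E"
    and p: "0 < p" "p < 1" and q: "0 < q"
    and q_le: "\<And>u. u \<in> A \<Longrightarrow> q \<le> (\<Prod>f | f \<in> E \<and> u \<in> f. 1 - p ^ (card f - 1))"
begin

definition star :: "'a \<Rightarrow> 'a set set" where "star u = {f \<in> E. u \<in> f}"

definition link :: "'a \<Rightarrow> 'a set \<Rightarrow> ('a + 'a) set" where "link u f = Inl ` (f - {u})"

text \<open>
  The random subset of \<open>A <+> A\<close> encodes \<open>C\<close> in its left part and, in its right part, the coin flips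
  that lower the survival probability of each vertex to exactly \<open>q\<close>.
\<close>

definition coin :: "'a \<Rightarrow> real" where "coin u = q / (\<Prod>f\<in>star u. 1 - p ^ (card f - 1))"

definition prb :: "'a + 'a \<Rightarrow> real" where "prb = case_sum (\<lambda>_. p) coin"

abbreviation expect :: "(('a + 'a) set \<Rightarrow> real) \<Rightarrow> real" where
  "expect \<equiv> bexp (A <+> A) prb"

definition survives :: "'a \<Rightarrow> 'a set set \<Rightarrow> ('a + 'a) set \<Rightarrow> bool" where
  "survives u F Z \<longleftrightarrow> Inr u \<in> Z \<and> (\<forall>f\<in>F. \<not> link u f \<subseteq> Z)"

definition scope :: "'a \<Rightarrow> 'a set set \<Rightarrow> ('a + 'a) set" where
  "scope u F = insert (Inr u) (\<Union>f\<in>F. link u f)"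

text \<open>
  A local event that holds whenever the trace of \<open>f\<close> after the round contains \<open>u\<close> and has size \<open>i\<close>.
  Ignoring \<open>f\<close> itself in the survival of the other vertices makes all the events in it independent.
\<close>

definition shrinks :: "nat \<Rightarrow> 'a \<Rightarrow> 'a set \<Rightarrow> ('a + 'a) set \<Rightarrow> bool" where
  "shrinks i u f Z \<longleftrightarrow> (\<exists>R \<subseteq> f - {u}. card R = i - 1 \<and> Inl ` (f - {u} - R) \<subseteq> Z \<and>
    (\<forall>w\<in>R. survives w (star w - {f}) Z))"

section \<open>Probabilities and independence of the local events\<close>

lemma finite_E: "finite E"
  using finite_A E_sub by (meson PowI finite_Pow_iff finite_subset subsetI)

lemma finite_star: "finite (star u)"
  using finite_E unfolding star_def by auto

lemma finite_edge: "f \<in> E \<Longrightarrow> finite f"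
  using E_sub finite_A finite_subset by blast

lemma finite_ground: "finite (A <+> A)"
  using finite_A by simp

lemma factor_pos: "f \<in> E \<Longrightarrow> 0 < 1 - p ^ (card f - 1)"
  using p E_card[of f] by (simp add: power_less_one_iff)

lemma prod_star_pos: "F \<subseteq> star u \<Longrightarrow> 0 < (\<Prod>f\<in>F. 1 - p ^ (card f - 1))"
  using factor_pos by (intro prod_pos) (auto simp: star_def)

lemma coin_bounds: "u \<in> A \<Longrightarrow> 0 \<le> coin u \<and> coin u \<le> 1"
  using q q_le[of u] prod_star_pos[of "star u" u] unfolding coin_def star_def by simp

lemma prb_bounds: "z \<in> A <+> A \<Longrightarrow> 0 \<le> prb z \<and> prb z \<le> 1"
  using p coin_bounds unfolding prb_def by auto

lemma expect_link: "f \<in> star u \<Longrightarrow> expect (\<lambda>Z. of_bool (link u f \<subseteq> Z)) = p ^ (card f - 1)"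
proof -
  assume f: "f \<in> star u"
  then have "link u f \<subseteq> A <+> A" using E_sub unfolding link_def star_def by auto
  then have "expect (\<lambda>Z. of_bool (link u f \<subseteq> Z)) = (\<Prod>z\<in>link u f. prb z)"
    by (rule bexp_subset[OF finite_ground])
  also have "\<dots> = (\<Prod>z\<in>link u f. p)"
    by (rule prod.cong) (auto simp: link_def prb_def)
  also have "\<dots> = p ^ (card f - 1)"
    using f finite_edge unfolding link_def star_def by (simp add: card_image)
  finally show ?thesis .
qed

lemma links_disjoint:
  assumes "f \<in> star u" "g \<in> star u" "f \<noteq> g" shows "(f - {u}) \<inter> (g - {u}) = {}"
  using assms short_cycle_free_linear[OF scf, of f g u] unfolding star_def by blast

lemma depends_on_survives: "depends_on (survives u F) (scope u F)"
  unfolding depends_on_def survives_def scope_def by (intro allI) auto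

text \<open>The edges at \<open>u\<close> share only \<open>u\<close>, so their links are disjoint
  and the events of avoiding them are independent. A general \<open>F\<close> is allowed because
  \<open>shrinks\<close> leaves out one edge.\<close>

lemma expect_survives:
  assumes u: "u \<in> A" and F: "F \<subseteq> star u"
  shows "expect (\<lambda>Z. of_bool (survives u F Z)) = coin u * (\<Prod>f\<in>F. 1 - p ^ (card f - 1))"
proof -
  have fF: "finite F" using F finite_star finite_subset by blast
  have eq: "(\<lambda>Z. of_bool (survives u F Z)) =
      (\<lambda>Z. of_bool ({Inr u} \<subseteq> Z) * (\<Prod>f\<in>F. 1 - of_bool (link u f \<subseteq> Z)) :: real)"
  proof
    fix Z
    show "of_bool (survives u F Z) = of_bool ({Inr u} \<subseteq> Z) * (\<Prod>f\<in>F. 1 - of_bool (link u f \<subseteq> Z) :: real)"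
    proof (cases "\<exists>f\<in>F. link u f \<subseteq> Z")
      case True
      then have "(\<Prod>f\<in>F. 1 - of_bool (link u f \<subseteq> Z) :: real) = 0"
        using fF by auto
      then show ?thesis using True unfolding survives_def by auto
    next
      case False
      then show ?thesis unfolding survives_def by auto
    qed
  qed
  have "expect (\<lambda>Z. of_bool (survives u F Z)) = expect (\<lambda>Z. of_bool ({Inr u} \<subseteq> Z))
      * expect (\<lambda>Z. \<Prod>f\<in>F. 1 - of_bool (link u f \<subseteq> Z))"
    unfolding eq
  proof (rule bexp_mult_indep[OF finite_ground, where B = "{Inr u}" and B' = "\<Union>f\<in>F. link u f"])
    show "{Inr u} \<inter> (\<Union>f\<in>F. link u f) = {}" unfolding link_def by auto
    show "depends_on (\<lambda>Z. \<Prod>f\<in>F. 1 - of_bool (link u f \<subseteq> Z) :: real) (\<Union>f\<in>F. link u f)"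
      by (rule depends_on_prod) (auto simp: depends_on_def)
  qed (auto simp: depends_on_def)
  also have "expect (\<lambda>Z. of_bool ({Inr u} \<subseteq> Z)) = coin u"
    using u by (subst bexp_subset[OF finite_ground]) (auto simp: prb_def)
  also have "expect (\<lambda>Z. \<Prod>f\<in>F. 1 - of_bool (link u f \<subseteq> Z))
      = (\<Prod>f\<in>F. expect (\<lambda>Z. 1 - of_bool (link u f \<subseteq> Z)))"
  proof (rule bexp_prod_indep[OF finite_ground fF, where B = "link u"])
    show "disjoint_family_on (link u) F"
      using links_disjoint F unfolding disjoint_family_on_def link_def by blast
  qed (auto simp: depends_on_def)
  also have "\<dots> = (\<Prod>f\<in>F. 1 - p ^ (card f - 1))"
    using F expect_link by (intro prod.cong) (auto simp: bexp_diff bexp_const[OF finite_ground])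
  finally show ?thesis .
qed

lemma expect_survives_star: "u \<in> A \<Longrightarrow> expect (\<lambda>Z. of_bool (survives u (star u) Z)) = q"
  using expect_survives[of u "star u"] prod_star_pos[of "star u" u] unfolding coin_def by simp

text \<open>Leaving out \<open>f\<close> divides the probability \<open>q\<close> by the factor of
  \<open>f\<close>, which is at least \<open>1 - p\<close> because \<open>f\<close> has at least two
  vertices.\<close>

lemma expect_survives_remove:
  assumes "f \<in> star w"
  shows "expect (\<lambda>Z. of_bool (survives w (star w - {f}) Z)) \<le> q / (1 - p)"
proof -
  have f: "f \<in> E" "w \<in> A" using assms E_sub unfolding star_def by auto
  let ?P = "\<Prod>f\<in>star w - {f}. 1 - p ^ (card f - 1)"
  have pos: "0 < ?P" by (rule prod_star_pos) auto
  have "(\<Prod>f\<in>star w. 1 - p ^ (card f - 1)) = (1 - p ^ (card f - 1)) * ?P"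
    using assms finite_star by (rule prod.remove[rotated])
  then have "expect (\<lambda>Z. of_bool (survives w (star w - {f}) Z)) = q / (1 - p ^ (card f - 1))"
    using f pos by (subst expect_survives) (auto simp: coin_def)
  also have "\<dots> \<le> q / (1 - p)"
  proof (rule divide_left_mono)
    have "p ^ (card f - 1) \<le> p ^ 1" using p E_card[OF f(1)] by (intro power_decreasing) auto
    then show "1 - p \<le> 1 - p ^ (card f - 1)" by simp
    show "0 < (1 - p ^ (card f - 1)) * (1 - p)" using factor_pos[OF f(1)] p by simp
  qed (use q in auto)
  finally show ?thesis .
qed

text \<open>Links at \<open>u\<close> omit \<open>u\<close>, so the survival of \<open>u\<close>
  does not depend on whether \<open>u\<close> itself lies in \<open>C\<close>.\<close>

lemma expect_chosen_survives:
  assumes u: "u \<in> A"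
  shows "expect (\<lambda>Z. of_bool (Inl u \<in> Z \<and> survives u (star u) Z)) = p * q"
    and "expect (\<lambda>Z. of_bool (Inl u \<notin> Z \<and> survives u (star u) Z)) = (1 - p) * q"
proof -
  have "expect (\<lambda>Z. of_bool ({Inl u} \<subseteq> Z) * of_bool (survives u (star u) Z))
      = expect (\<lambda>Z. of_bool ({Inl u} \<subseteq> Z)) * expect (\<lambda>Z. of_bool (survives u (star u) Z))"
  proof (rule bexp_mult_indep[OF finite_ground, where B = "{Inl u}" and B' = "scope u (star u)"])
    show "depends_on (\<lambda>Z. of_bool (survives u (star u) Z) :: real) (scope u (star u))"
      by (rule depends_on_of_bool[OF depends_on_survives])
  qed (auto simp: depends_on_def scope_def link_def)
  also have "expect (\<lambda>Z. of_bool ({Inl u} \<subseteq> Z)) = p"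
    using u by (subst bexp_subset[OF finite_ground]) (auto simp: prb_def)
  finally show 1: "expect (\<lambda>Z. of_bool (Inl u \<in> Z \<and> survives u (star u) Z)) = p * q"
    using expect_survives_star[OF u] by (simp add: of_bool_conj)
  have eq: "(\<lambda>Z. of_bool (Inl u \<notin> Z \<and> survives u (star u) Z)) = (\<lambda>Z. of_bool (survives u (star u) Z)
      - of_bool (Inl u \<in> Z \<and> survives u (star u) Z) :: real)"
    by (auto simp: fun_eq_iff)
  show "expect (\<lambda>Z. of_bool (Inl u \<notin> Z \<and> survives u (star u) Z)) = (1 - p) * q"
    unfolding eq bexp_diff 1 expect_survives_star[OF u] by (simp add: algebra_simps)
qed

text \<open>A common coordinate would be a vertex on an edge \<open>h\<close> through
  \<open>w\<close> and an edge \<open>h'\<close> through \<open>w'\<close>. Either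
  \<open>h = h'\<close> meets \<open>f\<close> twice, or \<open>f\<close>, \<open>h\<close>,
  \<open>h'\<close> form a 3-cycle.\<close>

lemma scopes_disjoint:
  assumes f: "f \<in> E" "w \<in> f" "w' \<in> f" "w \<noteq> w'"
  shows "scope w (star w - {f}) \<inter> scope w' (star w' - {f}) = {}"
proof -
  have False if h: "h \<in> star w - {f}" "x \<in> h - {w}" "h' \<in> star w' - {f}" "x \<in> h' - {w'}" for h h' x
  proof (cases "h = h'")
    case True
    then show False using h f short_cycle_free_linear[OF scf, of h f w w'] unfolding star_def by auto
  next
    case False
    have "x \<notin> f" using h f short_cycle_free_linear[OF scf, of h f w x] unfolding star_def by auto
    then show False using h f False by (intro short_cycle_free_no_3cycle[OF scf, of f h h' w x w']) (auto simp: star_def)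
  qed
  then show ?thesis using f(4) unfolding scope_def link_def by blast
qed

lemma scope_edge_disjoint:
  assumes "f \<in> E" "w \<in> f"
  shows "Inl ` f \<inter> scope w (star w - {f}) = {}"
  using assms short_cycle_free_linear[OF scf, of _ f w] unfolding scope_def link_def star_def by blast

text \<open>A union bound over the set \<open>R\<close> of vertices that stay in the trace besides
  \<open>u\<close>. For fixed \<open>R\<close> the events that the rest of \<open>f\<close> lies in
  \<open>C\<close> and that each \<open>w\<close> in \<open>R\<close> survives the edges other than
  \<open>f\<close> read disjoint coordinates, so their probabilities multiply.\<close>

lemma expect_shrinks:
  assumes f: "f \<in> star u"
  shows "expect (\<lambda>Z. of_bool (shrinks i u f Z))
    \<le> ((card f - 1) choose (i - 1)) * p ^ (card f - 1 - (i - 1)) * (q / (1 - p)) ^ (i - 1)"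
proof -
  let ?RR = "{R. R \<subseteq> f - {u} \<and> card R = i - 1}"
  let ?T = "\<lambda>R Z. of_bool (Inl ` (f - {u} - R) \<subseteq> Z) * (\<Prod>w\<in>R. of_bool (survives w (star w - {f}) Z)) :: real"
  have fE: "f \<in> E" and ff: "finite (f - {u})" and fA: "f \<subseteq> A" and cf: "card (f - {u}) = card f - 1"
    using f finite_edge E_sub unfolding star_def by auto
  have fin: "finite ?RR" using ff by auto
  have "expect (\<lambda>Z. of_bool (shrinks i u f Z)) \<le> expect (\<lambda>Z. \<Sum>R\<in>?RR. ?T R Z)"
  proof (rule bexp_mono[OF prb_bounds])
    fix Z
    have nonneg: "0 \<le> ?T R Z" for R by (intro mult_nonneg_nonneg prod_nonneg) auto
    show "of_bool (shrinks i u f Z) \<le> (\<Sum>R\<in>?RR. ?T R Z)"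
    proof (cases "shrinks i u f Z")
      case True
      then obtain R where R: "R \<in> ?RR" "Inl ` (f - {u} - R) \<subseteq> Z" "\<forall>w\<in>R. survives w (star w - {f}) Z"
        unfolding shrinks_def by blast
      have "1 = ?T R Z" using R by simp
      also have "\<dots> \<le> (\<Sum>R\<in>?RR. ?T R Z)"
        using R(1) fin nonneg by (intro member_le_sum) auto
      finally show ?thesis using True by simp
    qed (use nonneg in \<open>auto intro: sum_nonneg\<close>)
  qed
  also have "\<dots> = (\<Sum>R\<in>?RR. expect (?T R))" by (rule bexp_sum)
  also have "\<dots> \<le> (\<Sum>R\<in>?RR. p ^ (card f - 1 - (i - 1)) * (q / (1 - p)) ^ (i - 1))"
  proof (rule sum_mono)
    fix R assume "R \<in> ?RR"
    then have R: "R \<subseteq> f - {u}" "card R = i - 1" by auto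
    have fR: "finite R" using R ff finite_subset by blast
    have dep: "depends_on (\<lambda>Z. of_bool (survives w (star w - {f}) Z) :: real) (scope w (star w - {f}))" for w
      by (rule depends_on_of_bool[OF depends_on_survives])
    have "expect (?T R) = expect (\<lambda>Z. of_bool (Inl ` (f - {u} - R) \<subseteq> Z))
        * expect (\<lambda>Z. \<Prod>w\<in>R. of_bool (survives w (star w - {f}) Z))"
    proof (rule bexp_mult_indep[OF finite_ground, where B = "Inl ` f"])
      show "Inl ` f \<inter> (\<Union>w\<in>R. scope w (star w - {f})) = {}"
        using scope_edge_disjoint[OF fE] R by blast
      show "depends_on (\<lambda>Z. of_bool (Inl ` (f - {u} - R) \<subseteq> Z) :: real) (Inl ` f)"
        unfolding depends_on_def by (intro allI arg_cong[where f = of_bool]) auto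
    qed (rule depends_on_prod, rule dep)
    also have "expect (\<lambda>Z. of_bool (Inl ` (f - {u} - R) \<subseteq> Z)) = (\<Prod>z\<in>Inl ` (f - {u} - R). prb z)"
      using fA by (intro bexp_subset[OF finite_ground]) auto
    also have "\<dots> = p ^ card (f - {u} - R)"
      by (subst prod.reindex) (auto simp: prb_def)
    also have "card (f - {u} - R) = card f - 1 - (i - 1)"
      using R cf fR by (simp add: card_Diff_subset)
    also have "expect (\<lambda>Z. \<Prod>w\<in>R. of_bool (survives w (star w - {f}) Z))
        = (\<Prod>w\<in>R. expect (\<lambda>Z. of_bool (survives w (star w - {f}) Z)))"
    proof (rule bexp_prod_indep[OF finite_ground fR _ dep])
      show "disjoint_family_on (\<lambda>w. scope w (star w - {f})) R"
        unfolding disjoint_family_on_def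
      proof (intro ballI impI)
        fix w w' assume "w \<in> R" "w' \<in> R" "w \<noteq> w'"
        then show "scope w (star w - {f}) \<inter> scope w' (star w' - {f}) = {}"
          using R by (intro scopes_disjoint[OF fE]) auto
      qed
    qed
    also have "p ^ (card f - 1 - (i - 1)) * \<dots> \<le> p ^ (card f - 1 - (i - 1)) * (\<Prod>w\<in>R. q / (1 - p))"
    proof (intro mult_left_mono prod_mono conjI)
      fix w assume "w \<in> R"
      then have "f \<in> star w" using R fE unfolding star_def by auto
      then show "expect (\<lambda>Z. of_bool (survives w (star w - {f}) Z)) \<le> q / (1 - p)"
        by (rule expect_survives_remove)
      show "0 \<le> expect (\<lambda>Z. of_bool (survives w (star w - {f}) Z))"
        by (rule bexp_nonneg[OF prb_bounds]) auto
    qed (use p in auto)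
    finally show "expect (?T R) \<le> p ^ (card f - 1 - (i - 1)) * (q / (1 - p)) ^ (i - 1)"
      using R by simp
  qed
  also have "\<dots> = ((card f - 1) choose (i - 1)) * p ^ (card f - 1 - (i - 1)) * (q / (1 - p)) ^ (i - 1)"
    using n_subsets[OF ff, of "i - 1"] cf by simp
  finally show ?thesis .
qed

text \<open>The coordinates that \<open>shrinks i u f\<close> reads.\<close>

definition region :: "'a \<Rightarrow> 'a set \<Rightarrow> ('a + 'a) set" where
  "region u f = link u f \<union> (\<Union>w\<in>f - {u}. scope w (star w - {f}))"

lemma depends_on_shrinks: "depends_on (shrinks i u f) (region u f)"
  unfolding depends_on_def
proof
  fix Z
  have "survives w (star w - {f}) Z = survives w (star w - {f}) (Z \<inter> region u f)" if "w \<in> f - {u}" for w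
  proof -
    have "depends_on (survives w (star w - {f})) (region u f)"
      using depends_on_survives by (rule depends_on_mono) (use that in \<open>auto simp: region_def\<close>)
    then show ?thesis unfolding depends_on_def by (elim allE)
  qed
  then have "(\<forall>w\<in>R. survives w (star w - {f}) Z) \<longleftrightarrow> (\<forall>w\<in>R. survives w (star w - {f}) (Z \<inter> region u f))"
    if "R \<subseteq> f - {u}" for R
    using that by (intro ball_cong refl) auto
  moreover have "Inl ` (f - {u} - R) \<subseteq> Z \<longleftrightarrow> Inl ` (f - {u} - R) \<subseteq> Z \<inter> region u f" for R
    unfolding region_def link_def by auto
  ultimately show "shrinks i u f Z = shrinks i u f (Z \<inter> region u f)"
    unfolding shrinks_def by (intro ex_cong1 conj_cong refl)
qed

text \<open>Regions reach the neighbouring edges of \<open>f\<close> and of \<open>g\<close>, so an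
  overlap closes a cycle through \<open>u\<close> with up to four edges. This is where the absence
  of 4-cycles is used.\<close>

lemma regions_disjoint:
  assumes f: "f \<in> star u" "g \<in> star u" "f \<noteq> g"
  shows "region u f \<inter> region u g = {}"
proof -
  have fg: "f \<in> E" "g \<in> E" "u \<in> f" "u \<in> g" using f unfolding star_def by auto
  have fgu: "x = u" if "x \<in> f" "x \<in> g" for x
    using short_cycle_free_linear[OF scf fg(1,2)] fg that f(3) by blast
  \<comment> \<open>A neighbouring edge \<open>h\<close> of \<open>f\<close> that meets
    \<open>g\<close> outside \<open>u\<close> gives the 3-cycle \<open>f\<close>, \<open>h\<close>,
    \<open>g\<close> through \<open>w\<close>, \<open>x\<close>, \<open>u\<close>.\<close>
  have edge: False if "f \<in> E" "g \<in> E" "f \<noteq> g" "u \<in> f" "u \<in> g" "w \<in> f - {u}" "h \<in> star w - {f}" "x \<in> h - {w}" "x \<in> g - {u}"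
    for f g w h x
  proof -
    have fgu: "x = u" if "x \<in> f" "x \<in> g" for x
      using short_cycle_free_linear[OF scf \<open>f \<in> E\<close> \<open>g \<in> E\<close>] \<open>u \<in> f\<close> \<open>u \<in> g\<close> that \<open>f \<noteq> g\<close> by blast
    have "h \<noteq> g" using fgu that(6,7) unfolding star_def by auto
    show False
      by (rule short_cycle_free_no_3cycle[OF scf, of f h g w x u])
        (use that(1-8) \<open>h \<noteq> g\<close> \<open>x \<in> g - {u}\<close> in \<open>auto simp: star_def\<close>)
  qed
  \<comment> \<open>Neighbouring edges on both sides give the 4-cycle \<open>f\<close>,
    \<open>h\<close>, \<open>k\<close>, \<open>g\<close> through \<open>w\<close>, \<open>x\<close>,
    \<open>z\<close>, \<open>u\<close>; if \<open>h = k\<close>, the previous case applies with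
    \<open>z\<close> for \<open>x\<close>.\<close>
  have two: False if w: "w \<in> f - {u}" "h \<in> star w - {f}" "x \<in> h - {w}"
      and z: "z \<in> g - {u}" "k \<in> star z - {g}" "x \<in> k - {z}" for w h x z k
  proof -
    have hk: "h \<in> E" "k \<in> E" using w z unfolding star_def by auto
    have "h \<noteq> g" using fgu w unfolding star_def by auto
    have "k \<noteq> f" using fgu z unfolding star_def by auto
    have "w \<noteq> z" using fgu w z by auto
    have "u \<notin> h" using short_cycle_free_linear[OF scf hk(1) fg(1), of u w] w fg unfolding star_def by auto
    have "u \<notin> k" using short_cycle_free_linear[OF scf hk(2) fg(2), of u z] z fg unfolding star_def by auto
    have "h \<noteq> k"
      using edge[of f g w h z] f w z fg \<open>w \<noteq> z\<close> unfolding star_def by auto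
    show False
      by (rule short_cycle_free_no_4cycle[OF scf fg(1) hk(1,2) fg(2), of w x z u])
        (use w z fg f(3) \<open>h \<noteq> k\<close> \<open>h \<noteq> g\<close> \<open>k \<noteq> f\<close> \<open>w \<noteq> z\<close> \<open>u \<notin> h\<close> in \<open>auto simp: star_def\<close>)
  qed
  have coins: False if "w \<in> f - {u}" "w \<in> g - {u}" for w using fgu that by auto
  show ?thesis
  proof (rule ccontr)
    assume "region u f \<inter> region u g \<noteq> {}"
    then obtain y where y: "y \<in> region u f" "y \<in> region u g" by auto
    show False
    proof (cases y)
      case (Inr w)
      then show False using y coins unfolding region_def link_def scope_def by auto
    next
      case (Inl x)
      have "x \<in> f - {u} \<or> (\<exists>w h. w \<in> f - {u} \<and> h \<in> star w - {f} \<and> x \<in> h - {w})"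
        using y(1) Inl unfolding region_def link_def scope_def by auto
      moreover have "x \<in> g - {u} \<or> (\<exists>w h. w \<in> g - {u} \<and> h \<in> star w - {g} \<and> x \<in> h - {w})"
        using y(2) Inl unfolding region_def link_def scope_def by auto
      ultimately show False
        using coins edge[OF fg(1,2) f(3) fg(3,4)] edge[OF fg(2,1) f(3)[symmetric] fg(4,3)] two by metis
    qed
  qed
qed

lemma shrinks_indep:
  assumes "f \<in> star u" "g \<in> star u" "f \<noteq> g"
  shows "expect (\<lambda>Z. of_bool (shrinks i u f Z) * of_bool (shrinks i u g Z))
    = expect (\<lambda>Z. of_bool (shrinks i u f Z)) * expect (\<lambda>Z. of_bool (shrinks i u g Z))"
  by (rule bexp_mult_indep[OF finite_ground regions_disjoint[OF assms]])
    (rule depends_on_of_bool[OF depends_on_shrinks])+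

text \<open>Grouping the edges at \<open>u\<close> by size bounds the mean by \<open>M\<close>, and
  Chebyshev's inequality applies by \<open>shrinks_indep\<close>.\<close>

lemma expect_many_shrink:
  assumes deg: "\<And>j. j \<in> {2..r} \<Longrightarrow> real (card {f \<in> star u. card f = j}) \<le> \<Delta> j"
    and i: "i \<in> {2..r}"
    and M: "(\<Sum>j\<in>{2..r}. \<Delta> j * (((j - 1) choose (i - 1)) * p ^ (j - i) * (q / (1 - p)) ^ (i - 1))) \<le> M"
    and K: "M < K"
  shows "expect (\<lambda>Z. of_bool (K < (\<Sum>f\<in>star u. of_bool (shrinks i u f Z)))) \<le> M / (K - M)\<^sup>2"
proof (rule bexp_chebyshev[OF finite_ground prb_bounds finite_star shrinks_indep _ K])
  let ?\<phi> = "\<lambda>j. real ((j - 1) choose (i - 1)) * p ^ (j - i) * (q / (1 - p)) ^ (i - 1)"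
  have "(\<Sum>f\<in>star u. expect (\<lambda>Z. of_bool (shrinks i u f Z))) \<le> (\<Sum>f\<in>star u. ?\<phi> (card f))"
  proof (rule sum_mono)
    fix f assume "f \<in> star u"
    moreover have "card f - 1 - (i - 1) = card f - i" using i by auto
    ultimately show "expect (\<lambda>Z. of_bool (shrinks i u f Z)) \<le> ?\<phi> (card f)"
      using expect_shrinks[of f u i] by simp
  qed
  also have "\<dots> = (\<Sum>j\<in>{2..r}. \<Sum>f\<in>{f \<in> star u. card f = j}. ?\<phi> (card f))"
    using E_card by (intro sum.group[symmetric] finite_star) (auto simp: star_def)
  also have "\<dots> = (\<Sum>j\<in>{2..r}. real (card {f \<in> star u. card f = j}) * ?\<phi> j)"
    by (intro sum.cong refl) simp
  also have "\<dots> \<le> (\<Sum>j\<in>{2..r}. \<Delta> j * ?\<phi> j)"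
    using deg p q by (intro sum_mono mult_right_mono) auto
  also have "\<dots> \<le> M" by (rule M)
  finally show "(\<Sum>f\<in>star u. expect (\<lambda>Z. of_bool (shrinks i u f Z))) \<le> M" .
qed

text \<open>A trace inside \<open>J\<close> with at least two vertices is forbidden by assumption.
  Otherwise some \<open>u\<close> in \<open>f\<close> has all other vertices of \<open>f\<close> in
  \<open>I\<close>, hence in \<open>C\<close>, so \<open>u\<close> is killed by \<open>f\<close>;
  but every vertex of \<open>I\<close> and \<open>J\<close> survives.\<close>

lemma trace_independent:
  fixes Z :: "('a + 'a) set"
  defines "I \<equiv> {u \<in> A. Inl u \<in> Z \<and> survives u (star u) Z}"
  assumes A': "A' \<subseteq> {u \<in> A. Inl u \<notin> Z \<and> survives u (star u) Z}" and J: "J \<subseteq> A'"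
    and indep: "\<And>f. f \<in> E \<Longrightarrow> f - I \<subseteq> A' \<Longrightarrow> 2 \<le> card (f - I) \<Longrightarrow> \<not> f - I \<subseteq> J"
    and f: "f \<in> E"
  shows "\<not> f \<subseteq> I \<union> J"
proof
  assume sub: "f \<subseteq> I \<union> J"
  then have "f - I \<subseteq> J" by auto
  then have le1: "card (f - I) < 2" using indep[OF f] J by (meson linorder_not_le subset_trans)
  have ff: "finite f" using f finite_edge by auto
  have "\<exists>u\<in>f. f - {u} \<subseteq> I"
  proof (cases "f - I = {}")
    case True
    moreover have "f \<noteq> {}" using E_card[OF f] by auto
    ultimately show ?thesis by blast
  next
    case False
    then have "card (f - I) = 1" using le1 ff by (simp add: card_gt_0_iff less_2_cases_iff)
    then obtain u where "f - I = {u}" by (auto simp: card_1_singleton_iff)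
    then show ?thesis by blast
  qed
  then obtain u where u: "u \<in> f" "f - {u} \<subseteq> I" by blast
  have "link u f \<subseteq> Z" using u(2) unfolding link_def I_def by auto
  moreover have "f \<in> star u" using u f unfolding star_def by auto
  moreover have "survives u (star u) Z" using u(1) sub J A' unfolding I_def by auto
  ultimately show False unfolding survives_def by auto
qed

text \<open>The witness for \<open>shrinks\<close> is the trace without \<open>u\<close>: its
  vertices survive all edges, in particular those other than \<open>f\<close>, and the rest of
  \<open>f\<close> lies in \<open>I\<close>, hence in \<open>C\<close>. Edges with equal traces only
  help the inequality.\<close>

lemma trace_degree:
  fixes Z :: "('a + 'a) set"
  defines "I \<equiv> {u \<in> A. Inl u \<in> Z \<and> survives u (star u) Z}"
  assumes A': "A' \<subseteq> {u \<in> A. Inl u \<notin> Z \<and> survives u (star u) Z}" and u: "u \<in> A'"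
  shows "real (card {f' \<in> {f - I | f. f \<in> E \<and> f - I \<subseteq> A'}. u \<in> f' \<and> card f' = i})
    \<le> (\<Sum>f\<in>star u. of_bool (shrinks i u f Z))"
proof -
  let ?S = "{f \<in> star u. shrinks i u f Z}"
  have "{f' \<in> {f - I | f. f \<in> E \<and> f - I \<subseteq> A'}. u \<in> f' \<and> card f' = i} \<subseteq> (\<lambda>f. f - I) ` ?S"
  proof
    fix f' assume "f' \<in> {f' \<in> {f - I | f. f \<in> E \<and> f - I \<subseteq> A'}. u \<in> f' \<and> card f' = i}"
    then obtain f where f: "f' = f - I" "f \<in> E" "f - I \<subseteq> A'" "u \<in> f" "u \<notin> I" "card (f - I) = i" by auto
    have "shrinks i u f Z"
      unfolding shrinks_def
    proof (intro exI[of _ "f - I - {u}"] conjI ballI)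
      show "card (f - I - {u}) = i - 1" using f finite_edge[of f] by simp
      show "Inl ` (f - {u} - (f - I - {u})) \<subseteq> Z" unfolding I_def by auto
      fix w assume "w \<in> f - I - {u}"
      then have "survives w (star w) Z" using f A' by auto
      then show "survives w (star w - {f}) Z" unfolding survives_def by auto
    qed auto
    then show "f' \<in> (\<lambda>f. f - I) ` ?S" using f unfolding star_def by auto
  qed
  then have "card {f' \<in> {f - I | f. f \<in> E \<and> f - I \<subseteq> A'}. u \<in> f' \<and> card f' = i} \<le> card ?S"
    using finite_star by (intro surj_card_le) auto
  also have "real (card ?S) = (\<Sum>f\<in>star u. of_bool (shrinks i u f Z))"
    using finite_star by (simp add: of_bool_def sum.If_cases Int_def)
  finally show ?thesis by simp
qed

text \<open>Per vertex, the independent set gains \<open>p * q\<close> in expectation and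
  \<open>(1 - p) * q\<close> survive outside \<open>C\<close>; each degree bound fails with
  probability at most \<open>\<epsilon>\<close>, and vertices where one fails are discarded. Some
  outcome reaches the expected value. The last conclusion allows later rounds to extend
  \<open>I\<close> inside \<open>A'\<close>.\<close>

lemma nibble_round:
  fixes \<Delta> M \<Delta>' :: "nat \<Rightarrow> real" and \<epsilon> g :: real
  assumes deg: "\<And>u j. u \<in> A \<Longrightarrow> j \<in> {2..r} \<Longrightarrow> real (card {f \<in> E. u \<in> f \<and> card f = j}) \<le> \<Delta> j"
    and M: "\<And>i. i \<in> {2..r} \<Longrightarrow>
      (\<Sum>j\<in>{2..r}. \<Delta> j * (((j - 1) choose (i - 1)) * p ^ (j - i) * (q / (1 - p)) ^ (i - 1))) \<le> M i"
    and \<Delta>': "\<And>i. i \<in> {2..r} \<Longrightarrow> M i < \<Delta>' i \<and> M i / (\<Delta>' i - M i)\<^sup>2 \<le> \<epsilon>"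
    and \<epsilon>: "0 \<le> \<epsilon>" and g: "0 \<le> g"
  obtains I A' E' where "I \<subseteq> A" "A' \<subseteq> A" "I \<inter> A' = {}"
    "\<And>f. f \<in> E' \<Longrightarrow> f \<subseteq> A' \<and> 2 \<le> card f \<and> card f \<le> r" "short_cycle_free E'"
    "\<And>u i. u \<in> A' \<Longrightarrow> i \<in> {2..r} \<Longrightarrow> real (card {f \<in> E'. u \<in> f \<and> card f = i}) \<le> \<Delta>' i"
    "card A * (p * q + g * ((1 - p) * q - r * \<epsilon>)) \<le> card I + g * card A'"
    "\<And>J f. J \<subseteq> A' \<Longrightarrow> (\<And>f. f \<in> E' \<Longrightarrow> \<not> f \<subseteq> J) \<Longrightarrow> f \<in> E \<Longrightarrow> \<not> f \<subseteq> I \<union> J"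
proof -
  define bad where "bad i u Z \<longleftrightarrow> \<Delta>' i < (\<Sum>f\<in>star u. of_bool (shrinks i u f Z))" for i u Z
  define II where "II Z = {u \<in> A. Inl u \<in> Z \<and> survives u (star u) Z}" for Z
  define AA where "AA Z = {u \<in> A. (Inl u \<notin> Z \<and> survives u (star u) Z) \<and> (\<forall>i\<in>{2..r}. \<not> bad i u Z)}" for Z
  have bad: "expect (\<lambda>Z. of_bool (bad i u Z)) \<le> \<epsilon>" if "u \<in> A" "i \<in> {2..r}" for u i
  proof -
    have "expect (\<lambda>Z. of_bool (bad i u Z)) \<le> M i / (\<Delta>' i - M i)\<^sup>2"
      unfolding bad_def
    proof (rule expect_many_shrink[OF _ that(2) M[OF that(2)]])
      show "real (card {f \<in> star u. card f = j}) \<le> \<Delta> j" if "j \<in> {2..r}" for j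
        using deg[OF \<open>u \<in> A\<close> that] unfolding star_def by simp
    qed (use \<Delta>' that in auto)
    then show ?thesis using \<Delta>' that by force
  qed
  \<comment> \<open>A lower bound for the weighted size that is a sum over single events:
    subtracting every \<open>bad\<close> indicator is a union bound for the discarded
    vertices.\<close>
  define \<Phi> :: "('a + 'a) set \<Rightarrow> real" where "\<Phi> Z = (\<Sum>u\<in>A. of_bool (Inl u \<in> Z \<and> survives u (star u) Z)
      + g * (of_bool (Inl u \<notin> Z \<and> survives u (star u) Z) - (\<Sum>i\<in>{2..r}. of_bool (bad i u Z))))" for Z
  have "card A * (p * q + g * ((1 - p) * q - r * \<epsilon>)) = (\<Sum>u\<in>A. p * q + g * ((1 - p) * q - r * \<epsilon>))"
    by simp
  also have "\<dots> \<le> (\<Sum>u\<in>A. p * q + g * ((1 - p) * q - (\<Sum>i\<in>{2..r}. expect (\<lambda>Z. of_bool (bad i u Z)))))"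
  proof (intro sum_mono add_left_mono mult_left_mono diff_left_mono g)
    fix u assume u: "u \<in> A"
    have "(\<Sum>i\<in>{2..r}. expect (\<lambda>Z. of_bool (bad i u Z))) \<le> (\<Sum>i\<in>{2..r}. \<epsilon>)"
      using bad u by (intro sum_mono) auto
    also have "\<dots> \<le> r * \<epsilon>" using \<epsilon> by (simp add: mult_right_mono)
    finally show "(\<Sum>i\<in>{2..r}. expect (\<lambda>Z. of_bool (bad i u Z))) \<le> r * \<epsilon>" .
  qed
  also have "\<dots> = expect \<Phi>"
    unfolding \<Phi>_def bexp_sum bexp_add bexp_cmult bexp_diff
    using expect_chosen_survives by (intro sum.cong) auto
  finally have le: "card A * (p * q + g * ((1 - p) * q - r * \<epsilon>)) \<le> expect \<Phi>" .
  obtain Z where Z: "expect \<Phi> \<le> \<Phi> Z"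
    using bexp_attained[OF finite_ground, of prb \<Phi>] prb_bounds by blast
  have "\<Phi> Z \<le> (\<Sum>u\<in>A. of_bool (u \<in> II Z) + g * of_bool (u \<in> AA Z))"
    unfolding \<Phi>_def
  proof (intro sum_mono add_mono mult_left_mono g)
    fix u assume u: "u \<in> A"
    show "of_bool (Inl u \<in> Z \<and> survives u (star u) Z) \<le> (of_bool (u \<in> II Z) :: real)"
      using u unfolding II_def by auto
    show "of_bool (Inl u \<notin> Z \<and> survives u (star u) Z) - (\<Sum>i\<in>{2..r}. of_bool (bad i u Z))
        \<le> (of_bool (u \<in> AA Z) :: real)"
    proof (cases "\<exists>i\<in>{2..r}. bad i u Z")
      case True
      then obtain i where i: "i \<in> {2..r}" "bad i u Z" by auto
      have "of_bool (bad i u Z) \<le> (\<Sum>i\<in>{2..r}. of_bool (bad i u Z) :: real)"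
        using i by (intro member_le_sum) auto
      then show ?thesis using i by (auto simp: of_bool_def split: if_splits)
    next
      case False
      then have "of_bool (Inl u \<notin> Z \<and> survives u (star u) Z) = (of_bool (u \<in> AA Z) :: real)"
        using u unfolding AA_def by (intro arg_cong[where f = of_bool]) auto
      moreover have "0 \<le> (\<Sum>i\<in>{2..r}. of_bool (bad i u Z) :: real)" by (intro sum_nonneg) auto
      ultimately show ?thesis by linarith
    qed
  qed
  also have "\<dots> = card (II Z) + g * card (AA Z)"
  proof -
    have "(\<Sum>u\<in>A. of_bool (u \<in> S)) = real (card S)" if "S \<subseteq> A" for S
      using that finite_A by (simp add: of_bool_def sum.If_cases Int_absorb1)
    from this[of "II Z"] this[of "AA Z"] show ?thesis
      by (simp add: sum.distrib sum_distrib_left[symmetric] II_def AA_def)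
  qed
  finally have size: "\<Phi> Z \<le> card (II Z) + g * card (AA Z)" .
  \<comment> \<open>Smaller traces may be dropped: \<open>trace_independent\<close> shows that they
    cannot end up inside the final set.\<close>
  define E' where "E' = {f' \<in> {f - II Z | f. f \<in> E \<and> f - II Z \<subseteq> AA Z}. 2 \<le> card f'}"
  have AA: "AA Z \<subseteq> {u \<in> A. Inl u \<notin> Z \<and> survives u (star u) Z}" unfolding AA_def by auto
  show thesis
  proof (rule that[of "II Z" "AA Z" E'])
    show "card A * (p * q + g * ((1 - p) * q - r * \<epsilon>)) \<le> card (II Z) + g * card (AA Z)"
      using le Z size by linarith
    show "f \<subseteq> AA Z \<and> 2 \<le> card f \<and> card f \<le> r" if f: "f \<in> E'" for f
    proof -
      obtain h where h: "f = h - II Z" "h \<in> E" using f unfolding E'_def by auto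
      then have "card f \<le> card h" using finite_edge by (intro card_mono) auto
      then show ?thesis using f E_card[OF h(2)] unfolding E'_def by auto
    qed
    show "short_cycle_free E'"
      by (rule short_cycle_free_shrink[OF scf, of _ "\<lambda>f. f - II Z"]) (auto simp: E'_def)
    show "real (card {f \<in> E'. u \<in> f \<and> card f = i}) \<le> \<Delta>' i" if ui: "u \<in> AA Z" "i \<in> {2..r}" for u i
    proof -
      have "{f \<in> E'. u \<in> f \<and> card f = i} \<subseteq> {f' \<in> {f - II Z | f. f \<in> E \<and> f - II Z \<subseteq> AA Z}. u \<in> f' \<and> card f' = i}"
        unfolding E'_def by auto
      moreover have "finite {f - II Z | f. f \<in> E \<and> f - II Z \<subseteq> AA Z}" using finite_E by simp
      ultimately have "card {f \<in> E'. u \<in> f \<and> card f = i}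
          \<le> card {f' \<in> {f - II Z | f. f \<in> E \<and> f - II Z \<subseteq> AA Z}. u \<in> f' \<and> card f' = i}"
        by (intro card_mono) auto
      also have "real \<dots> \<le> (\<Sum>f\<in>star u. of_bool (shrinks i u f Z))"
        unfolding II_def by (rule trace_degree[OF AA ui(1)])
      also have "(\<Sum>f\<in>star u. of_bool (shrinks i u f Z)) \<le> \<Delta>' i"
        using ui unfolding AA_def bad_def by (simp add: not_less)
      finally show ?thesis by simp
    qed
    show "\<not> f \<subseteq> II Z \<union> J" if J: "J \<subseteq> AA Z" "\<And>f. f \<in> E' \<Longrightarrow> \<not> f \<subseteq> J" and f: "f \<in> E" for J f
      unfolding II_def
      by (rule trace_independent[OF AA J(1) _ f]) (rule J(2), auto simp: E'_def II_def)
  qed (auto simp: II_def AA_def)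
qed

end

section \<open>Iterating the nibble\<close>

lemma exp_le_one_minus:
  fixes x :: real assumes "0 \<le> x" "x \<le> 1 / 2" shows "exp (- 2 * x) \<le> 1 - x"
proof -
  have "x * x \<le> x * (1 / 2)" using assms by (intro mult_left_mono) auto
  then have "- 2 * x \<le> - x - 2 * x\<^sup>2" by (simp add: power2_eq_square)
  also have "\<dots> \<le> ln (1 - x)" by (rule ln_one_minus_pos_lower_bound[OF assms])
  finally show ?thesis using assms by (simp add: ln_ge_iff)
qed

lemma exp_le_prod_one_minus:
  fixes x :: "'i \<Rightarrow> real"
  assumes "\<And>i. i \<in> S \<Longrightarrow> 0 \<le> x i \<and> x i \<le> 1 / 2"
  shows "exp (- 2 * (\<Sum>i\<in>S. x i)) \<le> (\<Prod>i\<in>S. 1 - x i)"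
proof (cases "finite S")
  case True
  have "exp (- 2 * (\<Sum>i\<in>S. x i)) = (\<Prod>i\<in>S. exp (- 2 * x i))"
    using True by (simp add: sum_distrib_left exp_sum)
  also have "\<dots> \<le> (\<Prod>i\<in>S. 1 - x i)"
    using assms exp_le_one_minus by (intro prod_mono) auto
  finally show ?thesis .
qed auto

text \<open>Downward induction from \<open>T\<close>, where the empty set suffices because
  \<open>G T = 0\<close>. In the step, one round is played and the induction hypothesis is applied
  to its outcome, so \<open>G t\<close> is the guaranteed yield per vertex from round
  \<open>t\<close> on. The exponential bound on \<open>q\<close> implies the product bound of the
  locale by \<open>1 - z \<ge> exp (- 2 * z)\<close> for
  \<open>0 \<le> z \<le> 1 / 2\<close>.\<close>

lemma nibble_iterate:
  fixes r T :: nat and p q \<epsilon> G :: "nat \<Rightarrow> real" and \<Delta> M :: "nat \<Rightarrow> nat \<Rightarrow> real"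
  assumes p: "\<And>t. t < T \<Longrightarrow> 0 < p t \<and> p t \<le> 1 / 2"
    and q: "\<And>t. t < T \<Longrightarrow> 0 < q t \<and> q t \<le> exp (- 2 * (\<Sum>j\<in>{2..r}. \<Delta> t j * p t ^ (j - 1)))"
    and M: "\<And>t i. t < T \<Longrightarrow> i \<in> {2..r} \<Longrightarrow>
      (\<Sum>j\<in>{2..r}. \<Delta> t j * (((j - 1) choose (i - 1)) * p t ^ (j - i) * (q t / (1 - p t)) ^ (i - 1))) \<le> M t i"
    and \<Delta>: "\<And>t i. t < T \<Longrightarrow> i \<in> {2..r} \<Longrightarrow>
      M t i < \<Delta> (Suc t) i \<and> M t i / (\<Delta> (Suc t) i - M t i)\<^sup>2 \<le> \<epsilon> t"
    and \<epsilon>: "\<And>t. t < T \<Longrightarrow> 0 \<le> \<epsilon> t" and G0: "\<And>t. t \<le> T \<Longrightarrow> 0 \<le> G t" and GT: "G T = 0"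
    and G: "\<And>t. t < T \<Longrightarrow> G t \<le> p t * q t + G (Suc t) * ((1 - p t) * q t - r * \<epsilon> t)"
    and t: "t \<le> T" and A: "finite (A :: 'a set)"
    and E: "\<And>f. f \<in> E \<Longrightarrow> f \<subseteq> A \<and> 2 \<le> card f \<and> card f \<le> r" "short_cycle_free E"
    and deg: "\<And>u j. u \<in> A \<Longrightarrow> j \<in> {2..r} \<Longrightarrow> real (card {f \<in> E. u \<in> f \<and> card f = j}) \<le> \<Delta> t j"
  shows "\<exists>J\<subseteq>A. (\<forall>f\<in>E. \<not> f \<subseteq> J) \<and> card A * G t \<le> card J"
  using t A E deg
proof (induction t arbitrary: A E rule: inc_induct)
  case base
  have "\<not> f \<subseteq> {}" if "f \<in> E" for f using base.prems(2)[OF that] by auto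
  then show ?case using GT by (intro exI[of _ "{}"]) auto
next
  case (step t)
  have qle: "q t \<le> (\<Prod>f | f \<in> E \<and> u \<in> f. 1 - p t ^ (card f - 1))" if u: "u \<in> A" for u
  proof -
    let ?S = "{f \<in> E. u \<in> f}"
    have finE: "finite E" using step.prems(1,2) by (meson PowI finite_Pow_iff finite_subset subsetI)
    have half: "0 \<le> p t ^ (card f - 1) \<and> p t ^ (card f - 1) \<le> 1 / 2" if "f \<in> ?S" for f
    proof -
      have "p t ^ (card f - 1) \<le> p t ^ 1"
        using p[OF step.hyps(2)] step.prems(2)[of f] that by (intro power_decreasing) auto
      then show ?thesis using p[OF step.hyps(2)] by auto
    qed
    have "(\<Sum>f\<in>?S. p t ^ (card f - 1)) = (\<Sum>j\<in>{2..r}. \<Sum>f\<in>{f \<in> ?S. card f = j}. p t ^ (card f - 1))"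
      using step.prems(2) finE by (intro sum.group[symmetric]) auto
    also have "\<dots> = (\<Sum>j\<in>{2..r}. real (card {f \<in> E. u \<in> f \<and> card f = j}) * p t ^ (j - 1))"
      by (intro sum.cong refl) (simp add: conj_assoc)
    also have "\<dots> \<le> (\<Sum>j\<in>{2..r}. \<Delta> t j * p t ^ (j - 1))"
      using step.prems(4)[OF u] p[OF step.hyps(2)] by (intro sum_mono mult_right_mono) auto
    finally have "exp (- 2 * (\<Sum>j\<in>{2..r}. \<Delta> t j * p t ^ (j - 1))) \<le> exp (- 2 * (\<Sum>f\<in>?S. p t ^ (card f - 1)))"
      by simp
    also have "\<dots> \<le> (\<Prod>f\<in>?S. 1 - p t ^ (card f - 1))"
      by (rule exp_le_prod_one_minus) (rule half)
    finally show ?thesis using q[OF step.hyps(2)] by linarith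
  qed
  interpret nibble A E r "p t" "q t"
  proof
    show "f \<subseteq> A" "2 \<le> card f \<and> card f \<le> r" if "f \<in> E" for f
      using step.prems(2)[OF that] by blast+
    show "0 < p t" "p t < 1" "0 < q t" using p[OF step.hyps(2)] q[OF step.hyps(2)] by auto
  qed (use step.prems(1,3) qle in blast)+
  obtain I A' E' where R: "I \<subseteq> A" "A' \<subseteq> A" "I \<inter> A' = {}"
    "\<And>f. f \<in> E' \<Longrightarrow> f \<subseteq> A' \<and> 2 \<le> card f \<and> card f \<le> r" "short_cycle_free E'"
    "\<And>u i. u \<in> A' \<Longrightarrow> i \<in> {2..r} \<Longrightarrow> real (card {f \<in> E'. u \<in> f \<and> card f = i}) \<le> \<Delta> (Suc t) i"
    "card A * (p t * q t + G (Suc t) * ((1 - p t) * q t - r * \<epsilon> t)) \<le> card I + G (Suc t) * card A'"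
    "\<And>J f. J \<subseteq> A' \<Longrightarrow> (\<And>f. f \<in> E' \<Longrightarrow> \<not> f \<subseteq> J) \<Longrightarrow> f \<in> E \<Longrightarrow> \<not> f \<subseteq> I \<union> J"
    by (rule nibble_round[OF step.prems(4) M[OF step.hyps(2)] \<Delta>[OF step.hyps(2)] \<epsilon>[OF step.hyps(2)],
          of "G (Suc t)"]) (use G0[of "Suc t"] step.hyps in auto)
  have "finite A'" using R(2) step.prems(1) finite_subset by blast
  then obtain J where J: "J \<subseteq> A'" "\<forall>f\<in>E'. \<not> f \<subseteq> J" "card A' * G (Suc t) \<le> card J"
    using step.IH[of A' E'] R(4-6) by blast
  have "card A * G t \<le> card A * (p t * q t + G (Suc t) * ((1 - p t) * q t - r * \<epsilon> t))"
    using G[OF step.hyps(2)] by (intro mult_left_mono) auto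
  also have "\<dots> \<le> card I + card A' * G (Suc t)" using R(7) by (simp add: mult.commute)
  also have "\<dots> \<le> card I + card J" using J by simp
  also have "\<dots> = card (I \<union> J)"
  proof -
    have "finite I" "finite J" "I \<inter> J = {}"
      using J(1) R(1-3) finite_subset[OF _ finite_A] by blast+
    then show ?thesis by (simp add: card_Un_disjoint)
  qed
  finally have size: "card A * G t \<le> card (I \<union> J)" .
  have "\<forall>f\<in>E. \<not> f \<subseteq> I \<union> J" using R(8)[OF J(1)] J(2) by blast
  moreover have "I \<union> J \<subseteq> A" using R(1,2) J(1) by blast
  ultimately show ?case using size by blast
qed

text \<open>Give each of the other \<open>r - 1\<close> vertices of an edge weight \<open>a\<close>
  for being left and \<open>y\<close> for having been taken. If left vertices are now taken with
  weight \<open>p\<close>, the profile of trace sizes remains binomial, with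
  \<open>y + a * p\<close> in place of \<open>y\<close>. The proof regroups the binomial
  coefficients and applies the binomial theorem.\<close>

lemma trace_binomial:
  fixes a y p :: real
  assumes i: "1 \<le> i" "i \<le> r"
  shows "(\<Sum>j\<in>{1..r}. ((r - 1) choose (j - 1)) * a ^ (j - 1) * y ^ (r - j) * (((j - 1) choose (i - 1)) * p ^ (j - i)))
    = ((r - 1) choose (i - 1)) * a ^ (i - 1) * (y + a * p) ^ (r - i)"
proof -
  let ?h = "\<lambda>j. real ((r - 1) choose (j - 1)) * a ^ (j - 1) * y ^ (r - j) * (real ((j - 1) choose (i - 1)) * p ^ (j - i))"
  have "sum ?h {1..r} = sum ?h {i..r}"
    using i by (intro sum.mono_neutral_right) auto
  also have "\<dots> = (\<Sum>k\<in>{0..r-i}. ?h (k + i))"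
    using i sum.shift_bounds_cl_nat_ivl[of ?h 0 i "r - i"] by simp
  also have "\<dots> = (\<Sum>k\<in>{0..r-i}. (real ((r - 1) choose (i - 1)) * a ^ (i - 1)) * (((r - i) choose k) * (a * p) ^ k * y ^ (r - i - k)))"
  proof (rule sum.cong[OF refl])
    fix k assume "k \<in> {0..r-i}"
    then have k: "k \<le> r - i" by auto
    have "((r - 1) choose (k + i - 1)) * ((k + i - 1) choose (i - 1)) = ((r - 1) choose (i - 1)) * ((r - 1 - (i - 1)) choose (k + i - 1 - (i - 1)))"
      using i k by (intro choose_mult) auto
    moreover have "r - 1 - (i - 1) = r - i" "k + i - 1 - (i - 1) = k" using i by auto
    ultimately have c: "real ((r - 1) choose (k + i - 1)) * real ((k + i - 1) choose (i - 1)) = real ((r - 1) choose (i - 1)) * real ((r - i) choose k)"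
      by (metis of_nat_mult)
    have "a ^ (k + i - 1) = a ^ (i - 1) * a ^ k" using i by (simp add: power_add[symmetric] add.commute)
    moreover have "r - (k + i) = r - i - k" by simp
    ultimately have eq: "?h (k + i) = (real ((r - 1) choose (k + i - 1)) * real ((k + i - 1) choose (i - 1))) * (a ^ (i - 1) * a ^ k * y ^ (r - i - k) * p ^ k)"
      by simp
    show "?h (k + i) = (real ((r - 1) choose (i - 1)) * a ^ (i - 1)) * (((r - i) choose k) * (a * p) ^ k * y ^ (r - i - k))"
      unfolding eq c power_mult_distrib by (simp only: mult_ac)
  qed
  also have "\<dots> = real ((r - 1) choose (i - 1)) * a ^ (i - 1) * (a * p + y) ^ (r - i)"
    unfolding sum_distrib_left[symmetric] binomial_ring by (simp add: atLeast0AtMost)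
  finally show ?thesis by (simp add: add.commute)
qed

lemma power_diff_le:
  fixes a b :: real assumes "0 \<le> b" "b \<le> a" shows "a ^ n - b ^ n \<le> n * (a - b) * a ^ (n - 1)"
proof (induction n)
  case (Suc n)
  have "a ^ Suc n - b ^ Suc n = a * (a ^ n - b ^ n) + (a - b) * b ^ n" by (simp add: algebra_simps)
  also have "\<dots> \<le> a * (n * (a - b) * a ^ (n - 1)) + (a - b) * a ^ n"
    using Suc assms by (intro add_mono mult_left_mono power_mono) auto
  also have "\<dots> = Suc n * (a - b) * a ^ n" by (cases n) (auto simp: algebra_simps)
  finally show ?case by simp
qed simp

section \<open>Explicit parameters for all rounds\<close>

locale schedule =
  fixes r T :: nat
  assumes r: "3 \<le> r" and T: "r \<le> T"
begin

text \<open>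
  After \<open>t\<close> rounds a fraction \<open>x t\<close> of the vertices is left and the independent set has density at
  most \<open>y t\<close>, so that an edge through a remaining vertex has a trace of size \<open>j\<close> with probability
  about \<open>((r - 1) choose (j - 1)) * x t ^ (j - 1) * y t ^ (r - j)\<close>. The density \<open>s\<close> added
  per round is chosen such that \<open>D * y T ^ (r - 1)\<close> is \<open>T\<close>, a small multiple of \<open>ln D\<close>; then the kill
  rates telescope and \<open>x T\<close> remains a small negative power of \<open>D\<close>.
\<close>

definition \<rho> :: nat where "\<rho> = r - 1"

definition D :: real where "D = exp (16 * real \<rho> ^ 2 * T)"

definition s :: real where "s = (T / D) powr (1 / \<rho>) / (T + 1)"

definition y :: "nat \<Rightarrow> real" where "y t = (t + 1) * s"

text \<open>Normalised to \<open>x 0 = 1\<close>. The factor 4 is the 2 lost in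
  \<open>1 - z \<ge> exp (- 2 * z)\<close> times the bound 2 for
  \<open>\<gamma> ^ t\<close>.\<close>

definition x :: "nat \<Rightarrow> real" where "x t = exp (- 4 * D * (y t ^ \<rho> - s ^ \<rho>))"

definition p :: "nat \<Rightarrow> real" where "p t = s / x t"

definition q :: "nat \<Rightarrow> real" where "q t = x (Suc t) / x t"

text \<open>The slack of the degree bounds per round, small enough that its product over
  \<open>T\<close> rounds stays below 2.\<close>

definition \<gamma> :: real where "\<gamma> = 1 + 1 / (2 * T)"

definition \<Delta> :: "nat \<Rightarrow> nat \<Rightarrow> real" where
  "\<Delta> t j = ((r - 1) choose (j - 1)) * D * \<gamma> ^ t * x t ^ (j - 1) * y t ^ (r - j)"

text \<open>The mean stays below the next degree bound by a factor that leaves room for Chebyshev's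
  inequality; \<open>\<gamma>\<close> pays for it.\<close>

definition M :: "nat \<Rightarrow> nat \<Rightarrow> real" where
  "M t i = \<Delta> (Suc t) i / (1 + 1 / (4 * T))"

definition \<epsilon> :: real where "\<epsilon> = 25 * T ^ 2 * exp (- (9 * real \<rho> * T))"

definition \<kappa> :: real where "\<kappa> = exp (- (4 * real \<rho>))"

text \<open>Each of the \<open>T - t\<close> remaining rounds yields at least about
  \<open>\<kappa> * s / x t\<close> per present vertex; half of this is claimed, the other half pays
  for the losses.\<close>

definition G :: "nat \<Rightarrow> real" where "G t = \<kappa> * s * (real T - t) / (2 * x t)"

section \<open>Estimates for the parameters\<close>

lemma \<rho>: "2 \<le> \<rho>" "r = Suc \<rho>" "real \<rho> = real r - 1" and T0: "3 \<le> T"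
  using r T unfolding \<rho>_def by auto

lemma D_pos: "0 < D" unfolding D_def by simp

lemma s_pos: "0 < s" unfolding s_def using T0 D_pos by simp

lemma x_pos: "0 < x t" unfolding x_def by simp

lemma s_power: "D * ((T + 1) * s) ^ \<rho> = T"
proof -
  have "((T + 1) * s) ^ \<rho> = ((T / D) powr (1 / \<rho>)) ^ \<rho>" unfolding s_def by simp
  also have "\<dots> = T / D"
    using D_pos \<rho> T0 by (simp add: powr_realpow[symmetric] powr_powr)
  finally show ?thesis using D_pos by simp
qed

lemma s_upper: "s \<le> exp (- (16 * real \<rho> * T))"
proof -
  have "(T / D) powr (1 / \<rho>) = real T powr (1 / \<rho>) / D powr (1 / \<rho>)"
    using D_pos by (simp add: powr_divide)
  also have "D powr (1 / \<rho>) = exp (16 * real \<rho> * T)"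
    using \<rho> unfolding D_def by (simp add: powr_def power2_eq_square)
  also have "real T powr (1 / \<rho>) \<le> real T powr 1"
    using \<rho> T0 by (intro powr_mono) auto
  finally have "(T / D) powr (1 / \<rho>) \<le> (T + 1) * exp (- (16 * real \<rho> * T))"
    by (simp add: exp_minus field_simps divide_right_mono)
  then show ?thesis unfolding s_def using T0 by (simp add: field_simps)
qed

lemma y_le:
  assumes "t \<le> T" shows "y t \<le> (T + 1) * s"
  unfolding y_def using assms s_pos by (intro mult_right_mono) auto

lemma s_le_y: "s \<le> y t"
  unfolding y_def using s_pos by (simp add: algebra_simps)

lemma x_le_1: "x t \<le> 1"
  unfolding x_def using D_pos s_pos s_le_y[of t] power_mono[of s "y t" \<rho>] by (simp add: mult_le_0_iff)

text \<open>The kill rates add up to at most \<open>4 * D * ((T + 1) * s) ^ \<rho>\<close>, which is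
  \<open>4 * T\<close> by \<open>s_power\<close>.\<close>

lemma x_lower:
  assumes "t \<le> T" shows "exp (- (4 * real T)) \<le> x t"
proof -
  have "D * (y t ^ \<rho> - s ^ \<rho>) \<le> D * ((T + 1) * s) ^ \<rho>"
  proof (rule mult_left_mono)
    have "y t ^ \<rho> \<le> ((T + 1) * s) ^ \<rho>"
      using y_le[OF assms] s_le_y[of t] s_pos by (intro power_mono) auto
    moreover have "0 \<le> s ^ \<rho>" using s_pos by simp
    ultimately show "y t ^ \<rho> - s ^ \<rho> \<le> ((T + 1) * s) ^ \<rho>" by linarith
  qed (use D_pos in simp)
  then show ?thesis using s_power unfolding x_def by simp
qed

lemma y_Suc: "y (Suc t) = y t + s"
  unfolding y_def by (simp add: algebra_simps)

lemma q_eq: "q t = exp (- 4 * (D * (y (Suc t) ^ \<rho> - y t ^ \<rho>)))"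
  unfolding q_def x_def by (simp add: exp_diff[symmetric] algebra_simps)

text \<open>The increment of \<open>D * y t ^ \<rho>\<close> is at most
  \<open>\<rho> / (T + 1)\<close> times \<open>D * ((T + 1) * s) ^ \<rho> = T\<close>, hence at most
  \<open>\<rho>\<close>.\<close>

lemma q_lower:
  assumes "t < T" shows "\<kappa> \<le> q t"
proof -
  have "y (Suc t) ^ \<rho> - y t ^ \<rho> \<le> \<rho> * s * y (Suc t) ^ (\<rho> - 1)"
    using power_diff_le[of "y t" "y (Suc t)" \<rho>] y_Suc[of t] s_pos s_le_y[of t] by simp
  also have "\<dots> \<le> \<rho> * s * ((T + 1) * s) ^ (\<rho> - 1)"
    using y_le[of "Suc t"] assms s_pos s_le_y[of "Suc t"] by (intro mult_left_mono power_mono) auto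
  finally have "D * (y (Suc t) ^ \<rho> - y t ^ \<rho>) \<le> D * (\<rho> * s * ((T + 1) * s) ^ (\<rho> - 1))"
    using D_pos by (intro mult_left_mono) auto
  also have "\<dots> = \<rho> * (D * (((T + 1) * s) * ((T + 1) * s) ^ (\<rho> - 1))) / (T + 1)"
    by simp
  also have "((T + 1) * s) * ((T + 1) * s) ^ (\<rho> - 1) = ((T + 1) * s) ^ \<rho>"
    using \<rho> by (simp add: power_eq_if)
  also have "\<rho> * (D * ((T + 1) * s) ^ \<rho>) / (T + 1) \<le> \<rho>"
    unfolding s_power by (simp add: field_simps)
  finally show ?thesis unfolding q_eq \<kappa>_def by simp
qed

lemma T_le_exp: "real T \<le> exp (real T)"
  using exp_ge_add_one_self[of "real T"] by linarith

lemma p_pos: "0 < p t"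
  unfolding p_def using s_pos x_pos by simp

text \<open>Since \<open>s\<close> is at most \<open>exp (- (16 * \<rho> * T))\<close>, dividing by
  \<open>x t \<ge> exp (- (4 * T))\<close> leaves an exponentially small quantity. The factor
  \<open>r\<close> is for the powers of \<open>1 - p t\<close> in \<open>M_bound\<close>.\<close>

lemma p_upper:
  assumes "t \<le> T" shows "p t \<le> 1 / (8 * real r * real T)"
proof -
  have "real r * T \<le> real T * T" using T by (intro mult_right_mono) auto
  also have "\<dots> \<le> exp T * exp T" using T_le_exp by (intro mult_mono) auto
  finally have 1: "real r * T \<le> exp (2 * T)" by (simp add: exp_add[symmetric])
  have "8 \<le> exp (26 * real T)" using exp_ge_add_one_self[of "26 * real T"] T0 by linarith
  then have "8 * (real r * T) \<le> exp (26 * real T) * exp (2 * T)" using 1 by (intro mult_mono) auto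
  then have 2: "8 * (real r * T) \<le> exp (28 * real T)" by (simp add: exp_add[symmetric])
  have "p t \<le> exp (- (16 * real \<rho> * T)) / exp (- (4 * real T))"
    unfolding p_def using s_upper x_lower[OF assms] s_pos by (intro frac_le) auto
  also have "\<dots> = exp (- (16 * real \<rho> * T) + 4 * T)" by (simp add: exp_diff[symmetric])
  also have "\<dots> \<le> exp (- (28 * real T))"
  proof -
    have "16 * 2 * real T \<le> 16 * real \<rho> * T" using \<rho> by (intro mult_right_mono) auto
    then show ?thesis by simp
  qed
  also have "\<dots> = 1 / exp (28 * real T)" by (simp add: exp_minus field_simps)
  also have "\<dots> \<le> 1 / (8 * real r * real T)" using 2 r T0 by (intro divide_left_mono) auto
  finally show ?thesis .
qed

lemma p_upper':
  assumes "t \<le> T" shows "p t \<le> 1 / (8 * real T)" "p t \<le> 1 / 2"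
proof -
  have "1 / (8 * real r * real T) \<le> 1 / (8 * real T)" using r T0 by (intro divide_left_mono) auto
  moreover have "1 / (8 * real T) \<le> 1 / 2" using T0 by (intro divide_left_mono) auto
  ultimately show "p t \<le> 1 / (8 * real T)" "p t \<le> 1 / 2" using p_upper[OF assms] by linarith+
qed

lemma x_p: "x t * p t = s"
  unfolding p_def using x_pos[of t] by simp

lemma x_q: "x t * q t = x (Suc t)"
  unfolding q_def using x_pos[of t] by simp

lemma \<gamma>_power: "1 \<le> \<gamma> ^ t" "t \<le> T \<Longrightarrow> \<gamma> ^ t \<le> 2"
proof -
  show "1 \<le> \<gamma> ^ t" unfolding \<gamma>_def by (rule one_le_power) simp
  assume "t \<le> T"
  have "\<gamma> ^ t \<le> exp (1 / (2 * T)) ^ t"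
    unfolding \<gamma>_def by (intro power_mono) (auto simp: exp_ge_add_one_self)
  also have "\<dots> = exp (t * (1 / (2 * T)))" by (simp only: exp_of_nat_mult)
  also have "\<dots> \<le> exp (1 / 2)" using \<open>t \<le> T\<close> T0 by (simp add: field_simps)
  also have "\<dots> \<le> 2"
  proof -
    have "exp (1 / 2) ^ 2 = exp (1 :: real)" by (simp add: exp_double[symmetric])
    also have "\<dots> \<le> 2 ^ 2" using exp_le by simp
    finally show ?thesis by (rule power2_le_imp_le) simp
  qed
  finally show "\<gamma> ^ t \<le> 2" .
qed

lemma q_pos: "0 < q t"
  unfolding q_def using x_pos by simp

text \<open>The case \<open>i = 1\<close> of \<open>trace_binomial\<close>: the profile for
  \<open>j = 1\<close> is \<open>y t ^ \<rho>\<close> before and \<open>y (Suc t) ^ \<rho>\<close>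
  after the round, and the difference is the kill rate. This makes the rates telescope.\<close>

lemma q_upper:
  assumes "t < T" shows "q t \<le> exp (- 2 * (\<Sum>j\<in>{2..r}. \<Delta> t j * p t ^ (j - 1)))"
proof -
  let ?h = "\<lambda>j. real ((r - 1) choose (j - 1)) * x t ^ (j - 1) * y t ^ (r - j) * (real ((j - 1) choose (1 - 1)) * p t ^ (j - 1))"
  have "(\<Sum>j\<in>{1..r}. ?h j) = y (Suc t) ^ \<rho>"
    using trace_binomial[of 1 r "x t" "y t" "p t"] r by (simp add: x_p y_Suc \<rho>_def)
  moreover have "(\<Sum>j\<in>{1..r}. ?h j) = y t ^ \<rho> + (\<Sum>j\<in>{2..r}. ?h j)"
    using r by (subst sum.atLeast_Suc_atMost) (auto simp: \<rho>_def numeral_2_eq_2)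
  ultimately have "(\<Sum>j\<in>{2..r}. ?h j) = y (Suc t) ^ \<rho> - y t ^ \<rho>" by linarith
  moreover have "(\<Sum>j\<in>{2..r}. \<Delta> t j * p t ^ (j - 1)) = D * \<gamma> ^ t * (\<Sum>j\<in>{2..r}. ?h j)"
    unfolding \<Delta>_def sum_distrib_left by (intro sum.cong refl) simp
  ultimately have "(\<Sum>j\<in>{2..r}. \<Delta> t j * p t ^ (j - 1)) = \<gamma> ^ t * (D * (y (Suc t) ^ \<rho> - y t ^ \<rho>))"
    by simp
  also have "\<dots> \<le> 2 * (D * (y (Suc t) ^ \<rho> - y t ^ \<rho>))"
  proof (rule mult_right_mono)
    have "y t ^ \<rho> \<le> y (Suc t) ^ \<rho>" using y_Suc[of t] s_pos s_le_y[of t] by (intro power_mono) auto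
    then show "0 \<le> D * (y (Suc t) ^ \<rho> - y t ^ \<rho>)" using D_pos by simp
  qed (use \<gamma>_power(2)[of t] assms in auto)
  finally show ?thesis unfolding q_eq by simp
qed

text \<open>Chebyshev's inequality needs large degree bounds. As \<open>i \<ge> 2\<close>, at most
  \<open>\<rho> - 1\<close> factors of \<open>y t\<close> occur, and
  \<open>D * s ^ (\<rho> - 1)\<close> exceeds \<open>D * s ^ \<rho>\<close> by the huge factor
  \<open>1 / s\<close>; the loss from \<open>x t\<close> is at most
  \<open>exp (4 * \<rho> * T)\<close>.\<close>

lemma \<Delta>_lower:
  assumes "t \<le> T" "2 \<le> i" "i \<le> r" shows "exp (9 * real \<rho> * T) \<le> \<Delta> t i"
proof -
  have "s \<le> 1" using s_upper by (rule order_trans) simp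
  have "real T + 1 \<le> exp T" using exp_ge_add_one_self[of "real T"] by linarith
  then have "(T + 1) ^ \<rho> \<le> exp T ^ \<rho>" using power_mono[of "real T + 1" "exp T" \<rho>] by (simp add: add.commute)
  also have "\<dots> = exp (real \<rho> * T)" by (simp only: exp_of_nat_mult)
  finally have T\<rho>: "real (T + 1) ^ \<rho> \<le> exp (real \<rho> * T)" by simp
  have "1 \<le> real T" using T0 by simp
  also have "\<dots> = D * (s ^ (\<rho> - 1) * s) * (T + 1) ^ \<rho>"
  proof -
    have "s ^ (\<rho> - 1) * s = s ^ \<rho>" using \<rho> by (intro power_minus_mult) simp
    then show ?thesis using s_power by (simp add: power_mult_distrib mult_ac)
  qed
  also have "\<dots> \<le> D * (s ^ (\<rho> - 1) * exp (- (16 * real \<rho> * T))) * exp (real \<rho> * T)"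
    using T\<rho> s_upper s_pos D_pos by (intro mult_mono mult_left_mono) auto
  also have "\<dots> = D * s ^ (\<rho> - 1) * (exp (- (16 * real \<rho> * T)) * exp (real \<rho> * T))" by simp
  also have "exp (- (16 * real \<rho> * T)) * exp (real \<rho> * T) = inverse (exp (15 * real \<rho> * T))"
    by (simp only: exp_add[symmetric] exp_minus[symmetric]) simp
  finally have "exp (15 * real \<rho> * T) \<le> D * s ^ (\<rho> - 1)"
    by (simp add: field_simps)
  then have h1: "exp (15 * real \<rho> * T) * exp (- (4 * real T)) ^ \<rho> \<le> (D * s ^ (\<rho> - 1)) * exp (- (4 * real T)) ^ \<rho>"
    by (intro mult_right_mono) auto
  have h2: "exp (- (4 * real T)) ^ \<rho> = exp (\<rho> * (- (4 * real T)))" by (simp only: exp_of_nat_mult)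
  have h3: "exp (9 * real \<rho> * T) \<le> exp (15 * real \<rho> * T) * exp (\<rho> * (- (4 * real T)))"
    by (simp add: exp_add[symmetric])
  have "exp (9 * real \<rho> * T) \<le> (D * s ^ (\<rho> - 1)) * exp (- (4 * real T)) ^ \<rho>"
    unfolding h2 by (rule order_trans[OF h3 h1[unfolded h2]])
  also have "\<dots> \<le> (D * y t ^ (r - i)) * x t ^ (i - 1)"
  proof (intro mult_mono mult_left_mono)
    have "s ^ (\<rho> - 1) \<le> s ^ (r - i)" using \<open>s \<le> 1\<close> s_pos assms \<rho> by (intro power_decreasing) auto
    also have "\<dots> \<le> y t ^ (r - i)" using s_pos s_le_y by (intro power_mono) auto
    finally show "s ^ (\<rho> - 1) \<le> y t ^ (r - i)" .
    have "exp (- (4 * real T)) ^ \<rho> \<le> x t ^ \<rho>" using x_lower[OF assms(1)] by (intro power_mono) auto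
    also have "\<dots> \<le> x t ^ (i - 1)" using x_le_1 x_pos[of t] assms \<rho> by (intro power_decreasing) auto
    finally show "exp (- (4 * real T)) ^ \<rho> \<le> x t ^ (i - 1)" .
  qed (use D_pos s_pos s_le_y[of t] in auto)
  also have "\<dots> \<le> (((r - 1) choose (i - 1)) * \<gamma> ^ t) * ((D * y t ^ (r - i)) * x t ^ (i - 1))"
  proof -
    have "0 < (r - 1) choose (i - 1)" using assms by (intro zero_less_binomial) auto
    then have "1 \<le> real ((r - 1) choose (i - 1))" by linarith
    then have "1 * 1 \<le> real ((r - 1) choose (i - 1)) * \<gamma> ^ t"
      by (rule mult_mono[OF _ \<gamma>_power(1)]) simp_all
    moreover have "0 \<le> (D * y t ^ (r - i)) * x t ^ (i - 1)"
      using D_pos s_pos s_le_y[of t] x_pos[of t] by simp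
    ultimately have "1 * (D * y t ^ (r - i) * x t ^ (i - 1))
        \<le> real ((r - 1) choose (i - 1)) * \<gamma> ^ t * (D * y t ^ (r - i) * x t ^ (i - 1))"
      by (intro mult_right_mono) simp_all
    then show ?thesis by simp
  qed
  also have "\<dots> = \<Delta> t i" unfolding \<Delta>_def by simp
  finally show ?thesis .
qed

text \<open>\<open>trace_binomial\<close> reproduces the profile with \<open>y (Suc t)\<close>, and
  the factors \<open>q t\<close> turn \<open>x t\<close> into \<open>x (Suc t)\<close>. One factor
  \<open>\<gamma>\<close> pays for the powers of \<open>1 - p t\<close> and for the gap in
  \<open>M\<close>.\<close>

lemma M_bound:
  assumes t: "t < T" and i: "i \<in> {2..r}"
  shows "(\<Sum>j\<in>{2..r}. \<Delta> t j * (((j - 1) choose (i - 1)) * p t ^ (j - i) * (q t / (1 - p t)) ^ (i - 1))) \<le> M t i"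
proof -
  let ?h = "\<lambda>j. real ((r - 1) choose (j - 1)) * x t ^ (j - 1) * y t ^ (r - j) * (real ((j - 1) choose (i - 1)) * p t ^ (j - i))"
  have p1: "0 < 1 - p t" using p_upper'[of t] t by simp
  have "(\<Sum>j\<in>{2..r}. \<Delta> t j * (((j - 1) choose (i - 1)) * p t ^ (j - i) * (q t / (1 - p t)) ^ (i - 1)))
      = D * \<gamma> ^ t * (q t / (1 - p t)) ^ (i - 1) * (\<Sum>j\<in>{2..r}. ?h j)"
    unfolding \<Delta>_def sum_distrib_left by (intro sum.cong refl) simp
  \<comment> \<open>For \<open>j = 1\<close> the binomial coefficient vanishes because
    \<open>i \<ge> 2\<close>.\<close>
  also have "(\<Sum>j\<in>{2..r}. ?h j) = (\<Sum>j\<in>{1..r}. ?h j)"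
    using i by (intro sum.mono_neutral_left) (auto simp: not_le)
  also have "\<dots> = ((r - 1) choose (i - 1)) * x t ^ (i - 1) * y (Suc t) ^ (r - i)"
    using trace_binomial[of i r "x t" "y t" "p t"] i by (simp add: x_p y_Suc)
  also have "D * \<gamma> ^ t * (q t / (1 - p t)) ^ (i - 1) * \<dots>
      = \<Delta> (Suc t) i / \<gamma> / (1 - p t) ^ (i - 1)"
    unfolding \<Delta>_def x_q[symmetric] using \<gamma>_power(1)[of 1] by (simp add: power_divide power_mult_distrib)
  also have "\<dots> \<le> \<Delta> (Suc t) i / (1 + 1 / (4 * T))"
  proof -
    have "1 + 1 / (4 * T) \<le> \<gamma> * (1 - 1 / (8 * real T))"
      unfolding \<gamma>_def using T0 by (simp add: field_simps)
    also have "\<dots> \<le> \<gamma> * (1 - p t) ^ (i - 1)"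
    proof (rule mult_left_mono)
      have "(i - 1) * p t \<le> r * (1 / (8 * real r * real T))"
        using i p_upper[of t] p_pos[of t] t by (intro mult_mono) auto
      then have "1 - 1 / (8 * real T) \<le> 1 + (i - 1) * (- p t)" using r by simp
      also have "\<dots> \<le> (1 + (- p t)) ^ (i - 1)"
        using p_upper'[of t] t by (intro Bernoulli_inequality) auto
      finally show "1 - 1 / (8 * real T) \<le> (1 - p t) ^ (i - 1)" by simp
    qed (use \<gamma>_power(1)[of 1] in auto)
    finally have "1 + 1 / (4 * T) \<le> \<gamma> * (1 - p t) ^ (i - 1)" .
    moreover have "0 \<le> \<Delta> (Suc t) i" using \<Delta>_lower[of "Suc t" i] t i by (smt (verit) Suc_leI atLeastAtMost_iff exp_ge_zero)
    moreover have "0 < 1 + 1 / (4 * T)" "0 < \<gamma>" unfolding \<gamma>_def by (simp_all add: add_pos_nonneg)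
    moreover have "0 < (1 - p t) ^ (i - 1)" using p1 by simp
    ultimately show ?thesis unfolding divide_divide_eq_left by (intro divide_left_mono mult_pos_pos)
  qed
  finally show ?thesis unfolding M_def .
qed

text \<open>With \<open>a = 1 / (4 * T)\<close> the gap is \<open>a\<close> times the mean, so the
  quotient is \<open>(1 + a) / (a\<^sup>2 * d)\<close>, exponentially small by
  \<open>\<Delta>_lower\<close>.\<close>

lemma M_gap:
  assumes t: "t < T" and i: "i \<in> {2..r}"
  shows "M t i < \<Delta> (Suc t) i \<and> M t i / (\<Delta> (Suc t) i - M t i)\<^sup>2 \<le> \<epsilon>"
proof -
  define a where "a = 1 / (4 * real T)"
  define d where "d = \<Delta> (Suc t) i"
  have a: "0 < a" "a \<le> 1 / 2" using T0 unfolding a_def by (auto simp: field_simps)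
  have d: "exp (9 * real \<rho> * T) \<le> d" unfolding d_def using \<Delta>_lower[of "Suc t" i] t i by auto
  then have dpos: "0 < d" by (smt (verit) exp_gt_zero)
  have M: "M t i = d / (1 + a)" unfolding M_def d_def a_def by simp
  then have "d - M t i = a * M t i" using a by (simp add: field_simps)
  then have "M t i / (d - M t i)\<^sup>2 = 1 / (a\<^sup>2 * M t i)"
    by (simp add: power_mult_distrib power2_eq_square)
  also have "\<dots> = (1 + a) / (a\<^sup>2 * d)" unfolding M by simp
  also have "\<dots> \<le> (25 / 16) / (a\<^sup>2 * exp (9 * real \<rho> * T))"
    using a d by (intro frac_le mult_left_mono) auto
  also have "\<dots> = \<epsilon>" unfolding \<epsilon>_def a_def by (simp add: exp_minus field_simps power2_eq_square)
  finally have "M t i / (d - M t i)\<^sup>2 \<le> \<epsilon>" .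
  moreover have "M t i < d" unfolding M using a dpos by (simp add: field_simps)
  ultimately show ?thesis unfolding d_def by simp
qed

lemma \<epsilon>_upper: "r * \<epsilon> \<le> \<kappa> / (4 * T)"
proof -
  have "real T ^ 4 \<le> exp T ^ 4" using T_le_exp by (intro power_mono) auto
  also have "\<dots> = exp (4 * real T)" using exp_of_nat_mult[of 4 "real T"] by simp
  finally have 1: "real T ^ 4 \<le> exp (4 * real T)" .
  have "10 \<le> exp (3 * real T)" using exp_ge_add_one_self[of "3 * real T"] T0 by linarith
  then have "10 * 10 \<le> exp (3 * real T) * exp (3 * real T)" by (intro mult_mono) auto
  then have "100 * real T ^ 4 \<le> (exp (3 * real T) * exp (3 * real T)) * exp (4 * real T)"
    using 1 by (intro mult_mono) auto
  also have "\<dots> = exp (10 * real T)" by (simp add: exp_add[symmetric])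
  also have "\<dots> \<le> exp (9 * real \<rho> * T - 4 * real \<rho>)"
  proof -
    have "5 * 2 * real T \<le> 5 * real \<rho> * T" using \<rho> by (intro mult_right_mono) auto
    moreover have "4 * real \<rho> * 1 \<le> 4 * real \<rho> * T" using T0 by (intro mult_left_mono) auto
    ultimately show ?thesis by (simp add: algebra_simps)
  qed
  also have "\<dots> = \<kappa> * exp (9 * real \<rho> * T)" unfolding \<kappa>_def by (simp add: exp_add[symmetric])
  finally have 2: "100 * real T ^ 4 \<le> \<kappa> * exp (9 * real \<rho> * T)" .
  have "100 * (real r * T ^ 3) \<le> 100 * (real T * T ^ 3)" using T by (intro mult_left_mono mult_right_mono) auto
  also have "\<dots> = 100 * real T ^ 4" by (simp add: power_eq_if)
  finally have 3: "100 * (real r * T ^ 3) * exp (- (9 * real \<rho> * T)) \<le> \<kappa>"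
    using 2 by (simp add: exp_minus field_simps)
  have eq: "real r * \<epsilon> = 100 * (real r * T ^ 3) * exp (- (9 * real \<rho> * T)) / (4 * T)"
    unfolding \<epsilon>_def using T0 by (simp add: power_eq_if)
  show ?thesis unfolding eq using 3 by (intro divide_right_mono) auto
qed

text \<open>Vertices taken or discarded cost a fraction of at most
  \<open>1 / (8 * T) + 1 / (4 * T)\<close>, below \<open>1 / (2 * T)\<close>, of the survivors. On
  the later yield \<open>u * (k - 1) / 2\<close> this is less than \<open>u / 2\<close>, which the
  current round provides on top of the claimed \<open>u / 2\<close>.\<close>

lemma G_step:
  assumes t: "t < T"
  shows "G t \<le> p t * q t + G (Suc t) * ((1 - p t) * q t - r * \<epsilon>)"
proof -
  define u where "u = \<kappa> * s / x t"
  define k where "k = real T - t"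
  have u: "0 < u" unfolding u_def \<kappa>_def using s_pos x_pos by simp
  have k: "1 \<le> k" "k \<le> T" unfolding k_def using t by auto
  have Gt: "G t = u * k / 2" unfolding G_def u_def k_def by simp
  have GS: "G (Suc t) = u * (k - 1) / (2 * q t)"
    unfolding G_def u_def k_def x_q[symmetric] using x_pos[of t] q_pos[of t] by (simp add: algebra_simps)
  have pq: "u \<le> p t * q t"
    unfolding u_def p_def using q_lower[OF t] s_pos x_pos[of t] by (simp add: divide_right_mono mult_left_mono mult.commute)
  have "r * \<epsilon> \<le> q t / (4 * T)"
    using \<epsilon>_upper q_lower[OF t] by (rule order_trans[OF _ divide_right_mono]) auto
  moreover have "p t * q t \<le> 1 / (8 * real T) * q t"
    using p_upper'(1)[of t] t q_pos[of t] by (intro mult_right_mono) auto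
  moreover have "0 \<le> q t / (8 * T)" using q_pos[of t] by simp
  ultimately have "q t * (1 - 1 / (2 * T)) \<le> (1 - p t) * q t - r * \<epsilon>"
    using T0 by (simp add: field_simps)
  then have "u * (k - 1) / (2 * q t) * (q t * (1 - 1 / (2 * T))) \<le> G (Suc t) * ((1 - p t) * q t - r * \<epsilon>)"
    unfolding GS using u k q_pos[of t] by (intro mult_left_mono) auto
  also have "u * (k - 1) / (2 * q t) * (q t * (1 - 1 / (2 * T))) = u * ((k - 1) / 2 * (1 - 1 / (2 * T)))"
    using q_pos[of t] by simp
  finally have "u * ((k - 1) / 2 * (1 - 1 / (2 * T))) \<le> G (Suc t) * ((1 - p t) * q t - r * \<epsilon>)" .
  moreover have "u * (k / 2) \<le> u * (1 + (k - 1) / 2 * (1 - 1 / (2 * T)))"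
    using u k T0 by (intro mult_left_mono) (auto simp: field_simps)
  ultimately show ?thesis using pq unfolding Gt by (simp add: distrib_left)
qed

text \<open>The theorem of Ajtai, Komlos, Pintz, Spencer and Szemeredi for this \<open>D\<close>. At
  the start all edges have size \<open>r\<close> and \<open>\<Delta> 0 r = D\<close>; the value of
  \<open>G 0\<close> gives the bound by \<open>T + 1 \<le> 2 * T\<close>.\<close>

lemma uncrowded_independent:
  assumes A: "finite (A :: 'a set)" and E: "\<And>f. f \<in> E \<Longrightarrow> f \<subseteq> A \<and> card f = r"
    and scf: "short_cycle_free E"
    and deg: "\<And>u. u \<in> A \<Longrightarrow> real (card {f \<in> E. u \<in> f}) \<le> D"
  shows "\<exists>J\<subseteq>A. (\<forall>f\<in>E. \<not> f \<subseteq> J) \<and> card A * (\<kappa> / 4 * (T / D) powr (1 / \<rho>)) \<le> card J"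
proof -
  have "\<exists>J\<subseteq>A. (\<forall>f\<in>E. \<not> f \<subseteq> J) \<and> card A * G 0 \<le> card J"
  proof (rule nibble_iterate[where T = T and p = p and q = q and \<Delta> = \<Delta> and M = M and \<epsilon> = "\<lambda>_. \<epsilon>" and r = r])
    show "0 < p t \<and> p t \<le> 1 / 2" if "t < T" for t using that p_pos p_upper'(2)[of t] by auto
    show "0 < q t \<and> q t \<le> exp (- 2 * (\<Sum>j\<in>{2..r}. \<Delta> t j * p t ^ (j - 1)))" if "t < T" for t
      using q_pos q_upper[OF that] by auto
    show "0 \<le> G t" if "t \<le> T" for t
      using that s_pos x_pos[of t] unfolding G_def \<kappa>_def by simp
    show "real (card {f \<in> E. u \<in> f \<and> card f = j}) \<le> \<Delta> 0 j" if "u \<in> A" "j \<in> {2..r}" for u j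
    proof (cases "j = r")
      case True
      then have "{f \<in> E. u \<in> f \<and> card f = j} = {f \<in> E. u \<in> f}" using E by auto
      moreover have "\<Delta> 0 r = D" unfolding \<Delta>_def x_def y_def by simp
      ultimately show ?thesis using deg[OF that(1)] True by simp
    next
      case False
      then have e: "{f \<in> E. u \<in> f \<and> card f = j} = {}" using E by blast
      have "0 \<le> \<Delta> 0 j"
        using \<Delta>_lower[of 0 j] that(2) by (smt (verit) atLeastAtMost_iff exp_ge_zero le0)
      then show ?thesis unfolding e by simp
    qed
  qed (use A E scf r M_bound M_gap G_step in \<open>auto simp: \<epsilon>_def G_def\<close>)
  moreover have "\<kappa> / 4 * (T / D) powr (1 / \<rho>) \<le> G 0"
  proof -
    have "(T / D) powr (1 / \<rho>) = s * (T + 1)" unfolding s_def by simp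
    also have "\<dots> \<le> s * (2 * T)" using s_pos T0 by (intro mult_left_mono) auto
    finally have "\<kappa> / 4 * (T / D) powr (1 / \<rho>) \<le> \<kappa> / 4 * (s * (2 * T))"
      unfolding \<kappa>_def by (intro mult_left_mono) auto
    also have "\<dots> = G 0" unfolding G_def x_def y_def by simp
    finally show ?thesis .
  qed
  ultimately show ?thesis by (meson mult_left_mono of_nat_0_le_iff order_trans)
qed

end

section \<open>Sampling an uncrowded hypergraph\<close>

text \<open>Cycles are described by exposing edges one by one with given overlaps, the form in which
  they are counted. Without 2-cycles, a 3-cycle has overlaps 1 and 2. Without 3-cycles, opposite
  edges of a 4-cycle are disjoint, so its overlaps are 1, 1 and 2.\<close>

lemma short_cycle_freeI:
  assumes fin: "\<And>e. e \<in> E \<Longrightarrow> finite e"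
    and h2: "\<And>e f. e \<in> E \<Longrightarrow> f \<in> E \<Longrightarrow> f \<noteq> e \<Longrightarrow> \<not> 2 \<le> card (f \<inter> e)"
    and h3: "\<And>e f g. e \<in> E \<Longrightarrow> f \<in> E \<Longrightarrow> g \<in> E \<Longrightarrow> card (f \<inter> e) = 1 \<Longrightarrow> card (g \<inter> (e \<union> f)) \<noteq> 2"
    and h4: "\<And>e f g h. e \<in> E \<Longrightarrow> f \<in> E \<Longrightarrow> g \<in> E \<Longrightarrow> h \<in> E \<Longrightarrow> card (f \<inter> e) = 1 \<Longrightarrow>
      card (g \<inter> (e \<union> f)) = 1 \<Longrightarrow> card (h \<inter> (e \<union> f \<union> g)) \<noteq> 2"
  shows "short_cycle_free E"
proof -
  have lin: "e \<inter> f = {x}" if "e \<in> E" "f \<in> E" "e \<noteq> f" "x \<in> e" "x \<in> f" for e f x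
  proof -
    have "x \<in> e \<inter> f" "finite (e \<inter> f)" using that fin by auto
    moreover have "card (e \<inter> f) \<le> 1" using h2[OF that(2,1,3)] by linarith
    ultimately show ?thesis by (auto simp: card_le_Suc0_iff_eq)
  qed
  have tri: False if E: "e \<in> E" "f \<in> E" "g \<in> E" and d: "e \<noteq> f" "f \<noteq> g" "e \<noteq> g" "y \<noteq> z"
    and i: "x \<in> e" "x \<in> f" "y \<in> f" "y \<in> g" "z \<in> g" "z \<in> e" for e f g x y z
  proof -
    have "f \<inter> e = {x}" using lin[of f e x] E d i by auto
    moreover have "g \<inter> (e \<union> f) = {y, z}"
      using lin[of g f y] lin[of g e z] E d i by blast
    ultimately show False using h3[of e f g] E d by simp
  qed
  show ?thesis
    unfolding short_cycle_free_def
  proof (intro conjI ballI allI impI notI)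
    fix e f x y assume "e \<in> E" "f \<in> E" "e \<noteq> f" "x \<in> e \<inter> f" "y \<in> e \<inter> f"
    then show "x = y" using lin[of e f x] by auto
  next
    fix e f g x y z
    assume "e \<in> E" "f \<in> E" "g \<in> E" "distinct [e, f, g]" "distinct [x, y, z]"
      "x \<in> e \<inter> f \<and> y \<in> f \<inter> g \<and> z \<in> g \<inter> e"
    then show False by (intro tri[of e f g y z x]) auto
  next
    fix e f g h x y z w
    assume E: "e \<in> E" "f \<in> E" "g \<in> E" "h \<in> E"
      and d: "distinct [e, f, g, h]" "distinct [x, y, z, w]"
      and i: "x \<in> e \<inter> f \<and> y \<in> f \<inter> g \<and> z \<in> g \<inter> h \<and> w \<in> h \<inter> e"
    have xy: "x \<noteq> y" "y \<noteq> z" "z \<noteq> w" using d(2) by auto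
    have ef: "f \<inter> e = {x}" by (rule lin) (use E d(1) i in auto)
    have fg: "g \<inter> f = {y}" by (rule lin) (use E d(1) i in auto)
    have gh: "h \<inter> g = {z}" by (rule lin) (use E d(1) i in auto)
    have he: "h \<inter> e = {w}" by (rule lin) (use E d(1) i in auto)
    have "g \<inter> e = {}"
    proof (rule ccontr)
      assume "g \<inter> e \<noteq> {}"
      then obtain v where v: "v \<in> g" "v \<in> e" by auto
      have "y \<noteq> v"
      proof
        assume "y = v"
        then have "y \<in> f \<inter> e" using v i by simp
        then show False using ef xy by simp
      qed
      then show False by (rule tri[of e f g y v x, rotated 6]) (use E d(1) i v in auto)
    qed
    have "h \<inter> f = {}"
    proof (rule ccontr)
      assume "h \<inter> f \<noteq> {}"
      then obtain v where v: "v \<in> h" "v \<in> f" by auto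
      have "z \<noteq> v"
      proof
        assume "z = v"
        then have "z \<in> g \<inter> f" using v i by simp
        then show False using fg xy by simp
      qed
      then show False by (rule tri[of f g h z v y, rotated 6]) (use E d(1) i v in auto)
    qed
    have "g \<inter> (e \<union> f) = {y}" using \<open>g \<inter> e = {}\<close> fg by blast
    moreover have "h \<inter> (e \<union> f \<union> g) = {z, w}" using \<open>h \<inter> f = {}\<close> gh he by blast
    ultimately show False using h4[OF E] ef xy(3) by simp
  qed
qed

locale dense_hypergraph =
  fixes V :: "'a set" and E :: "'a set set" and r :: nat and \<delta> m :: real
  assumes V: "finite V" and E: "E \<subseteq> nsets V r" and r: "3 \<le> r"
    and codegree_le: "\<And>S. S \<in> nsets V (r - 1) \<Longrightarrow> real (codegree E S) \<le> \<delta> * card V"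
    and \<delta>: "0 < \<delta>" and m: "1 \<le> m" "m \<le> card V"
begin

definition pr :: real where "pr = m / card V"

text \<open>The order of the degrees in a sample of about \<open>m\<close> vertices: its expected
  number of edges is at most \<open>a * m\<close> by \<open>edge_weight\<close>.\<close>

definition a :: real where "a = \<delta> * m ^ (r - 1)"

abbreviation expect :: "('a set \<Rightarrow> real) \<Rightarrow> real" where
  "expect \<equiv> bexp V (\<lambda>_. pr)"

section \<open>Expected numbers of extensions and of short cycles\<close>

lemma edge: "e \<in> E \<Longrightarrow> e \<subseteq> V \<and> finite e \<and> card e = r"
  using E unfolding nsets_def by auto

lemma finite_E: "finite E"
  using V edge by (meson PowI finite_Pow_iff finite_subset subsetI)

lemma pr: "0 < pr" "pr \<le> 1" "card V * pr = m"
proof -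
  have "0 < real (card V)" using m by linarith
  then show "0 < pr" "pr \<le> 1" "card V * pr = m" using m unfolding pr_def by auto
qed

text \<open>The codegree bound is the case of \<open>r - 1\<close> prescribed vertices; each vertex
  fewer costs a factor of at most \<open>card V\<close>.\<close>

lemma extension_count:
  assumes "Q \<subseteq> V" "card Q + k = r - 1"
  shows "real (card {e \<in> E. Q \<subseteq> e}) \<le> \<delta> * card V ^ (k + 1)"
  using assms
proof (induction k arbitrary: Q)
  case 0
  then have "Q \<in> nsets V (r - 1)" using V finite_subset unfolding nsets_def by auto
  then show ?case using codegree_le unfolding codegree_def by simp
next
  case (Suc k)
  have fQ: "finite Q" using Suc.prems V finite_subset by blast
  have "{e \<in> E. Q \<subseteq> e} \<subseteq> (\<Union>v\<in>V - Q. {e \<in> E. insert v Q \<subseteq> e})"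
  proof
    fix e assume "e \<in> {e \<in> E. Q \<subseteq> e}"
    then have e: "e \<in> E" "Q \<subseteq> e" by auto
    have "card Q < card e" using edge[OF e(1)] Suc.prems r by auto
    then obtain v where "v \<in> e" "v \<notin> Q" using fQ by (metis card_mono not_le subsetI)
    moreover have "v \<in> V" using \<open>v \<in> e\<close> e(1) edge by blast
    ultimately show "e \<in> (\<Union>v\<in>V - Q. {e \<in> E. insert v Q \<subseteq> e})" using e by auto
  qed
  then have "card {e \<in> E. Q \<subseteq> e} \<le> card (\<Union>v\<in>V - Q. {e \<in> E. insert v Q \<subseteq> e})"
    using V finite_E by (intro card_mono) auto
  also have "\<dots> \<le> (\<Sum>v\<in>V - Q. card {e \<in> E. insert v Q \<subseteq> e})"
    using V by (intro card_UN_le) auto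
  finally have "real (card {e \<in> E. Q \<subseteq> e}) \<le> (\<Sum>v\<in>V - Q. real (card {e \<in> E. insert v Q \<subseteq> e}))"
    by (simp only: of_nat_sum[symmetric] of_nat_le_iff)
  also have "\<dots> \<le> (\<Sum>v\<in>V - Q. \<delta> * card V ^ (k + 1))"
  proof (rule sum_mono)
    fix v assume "v \<in> V - Q"
    then show "real (card {e \<in> E. insert v Q \<subseteq> e}) \<le> \<delta> * card V ^ (k + 1)"
      using Suc.prems fQ by (intro Suc.IH) auto
  qed
  also have "\<dots> \<le> card V * (\<delta> * card V ^ (k + 1))"
    using \<delta> V by (simp add: mult_right_mono card_mono)
  finally show ?case by (simp add: mult_ac)
qed

text \<open>There are \<open>card W choose j\<close> possible intersections with \<open>W\<close>.
  For each, the powers of \<open>card V\<close> in \<open>extension_count\<close> combine with the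
  sampling probabilities of the \<open>r - j\<close> new vertices into powers of
  \<open>m\<close>.\<close>

lemma extension_weight:
  assumes W: "W \<subseteq> V" and j: "j \<le> r - 1"
  shows "(\<Sum>e | e \<in> E \<and> card (e \<inter> W) = j. pr ^ card (e - W)) \<le> (card W choose j) * (\<delta> * m ^ (r - j))"
proof -
  let ?S = "{e \<in> E. card (e \<inter> W) = j}" and ?QQ = "{Q. Q \<subseteq> W \<and> card Q = j}"
  have fW: "finite W" using W V finite_subset by blast
  have "(\<Sum>e\<in>?S. pr ^ card (e - W)) = (\<Sum>Q\<in>?QQ. \<Sum>e\<in>{e \<in> ?S. e \<inter> W = Q}. pr ^ card (e - W))"
    using finite_E fW by (intro sum.group[symmetric]) auto
  also have "\<dots> \<le> (\<Sum>Q\<in>?QQ. \<delta> * m ^ (r - j))"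
  proof (rule sum_mono)
    fix Q assume Q: "Q \<in> ?QQ"
    have "(\<Sum>e\<in>{e \<in> ?S. e \<inter> W = Q}. pr ^ card (e - W)) = (\<Sum>e\<in>{e \<in> ?S. e \<inter> W = Q}. pr ^ (r - j))"
      using edge by (intro sum.cong refl) (auto simp: card_Diff_subset_Int)
    also have "\<dots> = real (card {e \<in> ?S. e \<inter> W = Q}) * pr ^ (r - j)" by simp
    also have "\<dots> \<le> real (card {e \<in> E. Q \<subseteq> e}) * pr ^ (r - j)"
      using pr finite_E by (intro mult_right_mono) (auto intro!: card_mono)
    also have "\<dots> \<le> \<delta> * card V ^ (r - 1 - j + 1) * pr ^ (r - j)"
      using Q W j pr by (intro mult_right_mono extension_count) auto
    also have "r - 1 - j + 1 = r - j" using j r by simp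
    also have "\<delta> * card V ^ (r - j) * pr ^ (r - j) = \<delta> * (card V * pr) ^ (r - j)"
      by (simp add: power_mult_distrib)
    finally show "(\<Sum>e\<in>{e \<in> ?S. e \<inter> W = Q}. pr ^ card (e - W)) \<le> \<delta> * m ^ (r - j)"
      unfolding pr(3) .
  qed
  also have "\<dots> = (card W choose j) * (\<delta> * m ^ (r - j))"
    using n_subsets[OF fW] by simp
  finally show ?thesis .
qed

lemma edge_weight: "(\<Sum>e\<in>E. pr ^ card e) \<le> a * m"
proof -
  have "m ^ r = m ^ (r - 1) * m" using r by (simp add: power_eq_if)
  then show ?thesis using extension_weight[of "{}" 0] unfolding a_def by simp
qed

lemma a_pos: "0 < a"
  unfolding a_def using \<delta> m by simp

text \<open>Attaching an edge at one old vertex costs order \<open>a\<close>, closing a cycle at two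
  old vertices only order \<open>a / m\<close>. Starting from expected weight \<open>a * m\<close>,
  cycles of length \<open>l\<close> have expected number of order \<open>a ^ l\<close>, without a
  factor \<open>m\<close>.\<close>

lemma choose_one_weight:
  assumes "W \<subseteq> V" "card W \<le> k"
  shows "(\<Sum>e | e \<in> E \<and> card (e \<inter> W) = 1. pr ^ card (e - W)) \<le> k * a"
proof -
  have "(\<Sum>e | e \<in> E \<and> card (e \<inter> W) = 1. pr ^ card (e - W)) \<le> card W * a"
    using extension_weight[OF assms(1), of 1] r unfolding a_def by simp
  also have "\<dots> \<le> k * a" using assms(2) a_pos by simp
  finally show ?thesis .
qed

lemma choose_two_weight:
  assumes "W \<subseteq> V" "card W \<le> k"
  shows "(\<Sum>e | e \<in> E \<and> card (e \<inter> W) = 2. pr ^ card (e - W)) \<le> k ^ 2 * (a / m)"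
proof -
  have a: "\<delta> * m ^ (r - 2) = a / m"
  proof -
    have "r - 1 = Suc (r - 2)" using r by simp
    then show ?thesis unfolding a_def using m by simp
  qed
  have "card W choose 2 \<le> card W * (card W - 1)" by (simp add: choose_two)
  also have "\<dots> \<le> k * k" using assms(2) by (intro mult_mono) auto
  finally have "real (card W choose 2) \<le> real k ^ 2"
    unfolding power2_eq_square by (metis of_nat_le_iff of_nat_mult)
  then have "(card W choose 2) * (a / m) \<le> real k ^ 2 * (a / m)"
    using a_pos m by (intro mult_right_mono) auto
  moreover have "2 \<le> r - 1" using r by simp
  ultimately show ?thesis using extension_weight[OF assms(1), of 2] unfolding a by simp
qed

text \<open>Distinct edges overlap in at most \<open>r - 1\<close> vertices, and as
  \<open>m \<ge> 1\<close> larger overlaps cost no more than overlaps in two; the binomial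
  coefficients sum to at most \<open>2 ^ r\<close>.\<close>

lemma overlap_weight:
  assumes "e \<in> E"
  shows "(\<Sum>f | f \<in> E \<and> f \<noteq> e \<and> 2 \<le> card (f \<inter> e). pr ^ card (f - e)) \<le> 2 ^ r * (a / m)"
proof -
  let ?S = "{f \<in> E. f \<noteq> e \<and> 2 \<le> card (f \<inter> e)}"
  have range: "card (f \<inter> e) \<in> {2..r - 1}" if "f \<in> ?S" for f
  proof -
    have f: "f \<in> E" "f \<noteq> e" using that by auto
    have "f \<inter> e \<noteq> e"
    proof
      assume "f \<inter> e = e"
      then have "e \<subseteq> f" by blast
      then have "e = f" using edge[OF f(1)] edge[OF assms] by (intro card_subset_eq) auto
      then show False using f(2) by simp
    qed
    then have "card (f \<inter> e) < card e" using edge[OF assms] by (intro psubset_card_mono) auto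
    then show ?thesis using that edge[OF assms] by auto
  qed
  have "(\<Sum>f\<in>?S. pr ^ card (f - e)) = (\<Sum>j\<in>{2..r - 1}. \<Sum>f\<in>{f \<in> ?S. card (f \<inter> e) = j}. pr ^ card (f - e))"
    by (intro sum.group[symmetric] image_subsetI range) (use finite_E in auto)
  also have "\<dots> \<le> (\<Sum>j\<in>{2..r - 1}. \<Sum>f | f \<in> E \<and> card (f \<inter> e) = j. pr ^ card (f - e))"
    using finite_E pr by (intro sum_mono sum_mono2) auto
  also have "\<dots> \<le> (\<Sum>j\<in>{2..r - 1}. (r choose j) * (a / m))"
  proof (rule sum_mono)
    fix j assume j: "j \<in> {2..r - 1}"
    have "(\<Sum>f | f \<in> E \<and> card (f \<inter> e) = j. pr ^ card (f - e)) \<le> (r choose j) * (\<delta> * m ^ (r - j))"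
      using extension_weight[of e j] edge[OF assms] j by auto
    also have "\<dots> \<le> (r choose j) * (\<delta> * m ^ (r - 2))"
      using m \<delta> j by (intro mult_left_mono power_increasing) auto
    also have "\<delta> * m ^ (r - 2) = a / m"
    proof -
      have "r - 1 = Suc (r - 2)" using r by simp
      then show ?thesis unfolding a_def using m by simp
    qed
    finally show "(\<Sum>f | f \<in> E \<and> card (f \<inter> e) = j. pr ^ card (f - e)) \<le> (r choose j) * (a / m)" .
  qed
  also have "\<dots> = (\<Sum>j\<in>{2..r - 1}. real (r choose j)) * (a / m)" by (rule sum_distrib_right[symmetric])
  also have "\<dots> \<le> (\<Sum>j\<in>{..r}. real (r choose j)) * (a / m)"
    using a_pos m by (intro mult_right_mono sum_mono2) auto
  also have "(\<Sum>j\<in>{..r}. real (r choose j)) = 2 ^ r"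
    using choose_row_sum[of r] by (metis of_nat_numeral of_nat_power of_nat_sum)
  finally show ?thesis .
qed

definition cycles2 :: "('a set \<times> 'a set) set" where
  "cycles2 = (SIGMA e:E. {f \<in> E. f \<noteq> e \<and> 2 \<le> card (f \<inter> e)})"

definition cycles3 :: "('a set \<times> 'a set \<times> 'a set) set" where
  "cycles3 = (SIGMA e:E. SIGMA f:{f \<in> E. card (f \<inter> e) = 1}. {g \<in> E. card (g \<inter> (e \<union> f)) = 2})"

definition cycles4 :: "('a set \<times> 'a set \<times> 'a set \<times> 'a set) set" where
  "cycles4 = (SIGMA e:E. SIGMA f:{f \<in> E. card (f \<inter> e) = 1}.
    SIGMA g:{g \<in> E. card (g \<inter> (e \<union> f)) = 1}. {h \<in> E. card (h \<inter> (e \<union> f \<union> g)) = 2})"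

lemma finite_cycles: "finite cycles2" "finite cycles3" "finite cycles4"
  using finite_E unfolding cycles2_def cycles3_def cycles4_def by (auto intro!: finite_SigmaI)

lemma pr_Un:
  assumes "W \<subseteq> V" "e \<in> E" shows "pr ^ card (W \<union> e) = pr ^ card W * pr ^ card (e - W)"
proof -
  have "finite W" "finite e" using assms V edge finite_subset by blast+
  then have "card (W \<union> (e - W)) = card W + card (e - W)" by (intro card_Un_disjoint) auto
  then show ?thesis by (simp add: power_add)
qed

lemma cycles2_weight: "(\<Sum>(e, f)\<in>cycles2. pr ^ card (e \<union> f)) \<le> 2 ^ r * a ^ 2"
proof -
  have "(\<Sum>(e, f)\<in>cycles2. pr ^ card (e \<union> f))
      = (\<Sum>e\<in>E. \<Sum>f | f \<in> E \<and> f \<noteq> e \<and> 2 \<le> card (f \<inter> e). pr ^ card (e \<union> f))"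
    unfolding cycles2_def using finite_E by (subst sum.Sigma) auto
  also have "\<dots> = (\<Sum>e\<in>E. pr ^ card e * (\<Sum>f | f \<in> E \<and> f \<noteq> e \<and> 2 \<le> card (f \<inter> e). pr ^ card (f - e)))"
    unfolding sum_distrib_left using edge by (intro sum.cong refl pr_Un) auto
  also have "\<dots> \<le> (\<Sum>e\<in>E. pr ^ card e * (2 ^ r * (a / m)))"
    using pr overlap_weight by (intro sum_mono mult_left_mono) auto
  also have "\<dots> = (\<Sum>e\<in>E. pr ^ card e) * (2 ^ r * (a / m))" by (rule sum_distrib_right[symmetric])
  also have "\<dots> \<le> a * m * (2 ^ r * (a / m))"
    using edge_weight a_pos m by (intro mult_right_mono) auto
  also have "\<dots> = 2 ^ r * a ^ 2" using m by (simp add: power2_eq_square)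
  finally show ?thesis .
qed

lemma card_Un_edge:
  assumes "W \<subseteq> V" "card W \<le> k * r" "e \<in> E"
  shows "W \<union> e \<subseteq> V \<and> card (W \<union> e) \<le> (k + 1) * r"
  using assms edge[OF assms(3)] card_Un_le[of W e] by auto

lemma cycles3_weight: "(\<Sum>(e, f, g)\<in>cycles3. pr ^ card (e \<union> f \<union> g)) \<le> 4 * r ^ 3 * a ^ 3"
proof -
  let ?F = "\<lambda>e. {f \<in> E. card (f \<inter> e) = 1}" and ?G = "\<lambda>W. {g \<in> E. card (g \<inter> W) = 2}"
  have "(\<Sum>(e, f, g)\<in>cycles3. pr ^ card (e \<union> f \<union> g))
      = (\<Sum>e\<in>E. \<Sum>f\<in>?F e. \<Sum>g\<in>?G (e \<union> f). pr ^ card (e \<union> f \<union> g))"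
    unfolding cycles3_def using finite_E by (simp add: sum.Sigma split_def)
  also have "\<dots> = (\<Sum>e\<in>E. \<Sum>f\<in>?F e. pr ^ card (e \<union> f) * (\<Sum>g\<in>?G (e \<union> f). pr ^ card (g - (e \<union> f))))"
    unfolding sum_distrib_left using edge by (intro sum.cong refl pr_Un) auto
  also have "\<dots> \<le> (\<Sum>e\<in>E. \<Sum>f\<in>?F e. pr ^ card (e \<union> f) * (real (2 * r) ^ 2 * (a / m)))"
  proof (intro sum_mono mult_left_mono)
    fix e f assume "e \<in> E" "f \<in> ?F e"
    then have "e \<union> f \<subseteq> V \<and> card (e \<union> f) \<le> (1 + 1) * r"
      using edge[of e] by (intro card_Un_edge) auto
    then show "(\<Sum>g\<in>?G (e \<union> f). pr ^ card (g - (e \<union> f))) \<le> real (2 * r) ^ 2 * (a / m)"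
      by (intro choose_two_weight) auto
  qed (use pr in auto)
  also have "\<dots> = (\<Sum>e\<in>E. pr ^ card e * (\<Sum>f\<in>?F e. pr ^ card (f - e))) * (real (2 * r) ^ 2 * (a / m))"
    unfolding sum_distrib_left sum_distrib_right using edge
    by (intro sum.cong refl arg_cong2[where f = "(*)"] pr_Un) auto
  also have "\<dots> \<le> (\<Sum>e\<in>E. pr ^ card e * (r * a)) * (real (2 * r) ^ 2 * (a / m))"
    using pr a_pos m edge by (intro mult_right_mono sum_mono mult_left_mono choose_one_weight) auto
  also have "\<dots> = (\<Sum>e\<in>E. pr ^ card e) * (r * a * (real (2 * r) ^ 2 * (a / m)))"
    by (simp only: sum_distrib_right mult.assoc)
  also have "\<dots> \<le> a * m * (r * a * (real (2 * r) ^ 2 * (a / m)))"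
    using edge_weight a_pos m by (intro mult_right_mono) auto
  also have "\<dots> = 4 * r ^ 3 * a ^ 3" using m by (simp add: power2_eq_square power3_eq_cube)
  finally show ?thesis .
qed

text \<open>The constant is \<open>2 * 3 ^ 2\<close>: the third edge attaches to one of at most
  \<open>2 * r\<close> vertices, the fourth to two of at most \<open>3 * r\<close>.\<close>

lemma cycles4_weight: "(\<Sum>(e, f, g, h)\<in>cycles4. pr ^ card (e \<union> f \<union> g \<union> h)) \<le> 18 * r ^ 4 * a ^ 4"
proof -
  let ?F = "\<lambda>W. {f \<in> E. card (f \<inter> W) = 1}" and ?G = "\<lambda>W. {g \<in> E. card (g \<inter> W) = 2}"
  have ef: "e \<union> f \<subseteq> V \<and> card (e \<union> f) \<le> 2 * r" if "e \<in> E" "f \<in> E" for e f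
    using card_Un_edge[of e 1 f] edge[OF that(1)] that by simp
  have efg: "e \<union> f \<union> g \<subseteq> V \<and> card (e \<union> f \<union> g) \<le> 3 * r" if "e \<in> E" "f \<in> E" "g \<in> E" for e f g
    using card_Un_edge[of "e \<union> f" 2 g] ef[OF that(1,2)] that by simp
  have "(\<Sum>(e, f, g, h)\<in>cycles4. pr ^ card (e \<union> f \<union> g \<union> h))
      = (\<Sum>e\<in>E. \<Sum>f\<in>?F e. \<Sum>g\<in>?F (e \<union> f). \<Sum>h\<in>?G (e \<union> f \<union> g). pr ^ card (e \<union> f \<union> g \<union> h))"
    unfolding cycles4_def using finite_E by (simp add: sum.Sigma split_def)
  also have "\<dots> = (\<Sum>e\<in>E. \<Sum>f\<in>?F e. \<Sum>g\<in>?F (e \<union> f). pr ^ card (e \<union> f \<union> g) *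
      (\<Sum>h\<in>?G (e \<union> f \<union> g). pr ^ card (h - (e \<union> f \<union> g))))"
    unfolding sum_distrib_left using edge by (intro sum.cong refl pr_Un) auto
  also have "\<dots> \<le> (\<Sum>e\<in>E. \<Sum>f\<in>?F e. \<Sum>g\<in>?F (e \<union> f). pr ^ card (e \<union> f \<union> g) * (real (3 * r) ^ 2 * (a / m)))"
    using efg pr by (intro sum_mono mult_left_mono choose_two_weight) auto
  also have "\<dots> = (\<Sum>e\<in>E. \<Sum>f\<in>?F e. pr ^ card (e \<union> f) * (\<Sum>g\<in>?F (e \<union> f). pr ^ card (g - (e \<union> f)))) * (real (3 * r) ^ 2 * (a / m))"
    unfolding sum_distrib_left sum_distrib_right using edge
    by (intro sum.cong refl arg_cong2[where f = "(*)"] pr_Un) auto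
  also have "\<dots> \<le> (\<Sum>e\<in>E. \<Sum>f\<in>?F e. pr ^ card (e \<union> f) * (real (2 * r) * a)) * (real (3 * r) ^ 2 * (a / m))"
    using pr a_pos m ef by (intro mult_right_mono sum_mono mult_left_mono choose_one_weight) auto
  also have "\<dots> = (\<Sum>e\<in>E. pr ^ card e * (\<Sum>f\<in>?F e. pr ^ card (f - e))) * (real (2 * r) * a * (real (3 * r) ^ 2 * (a / m)))"
    unfolding sum_distrib_left sum_distrib_right mult.assoc[symmetric] using edge
    by (intro sum.cong refl arg_cong2[where f = "(*)"] pr_Un) auto
  also have "\<dots> \<le> (\<Sum>e\<in>E. pr ^ card e * (r * a)) * (real (2 * r) * a * (real (3 * r) ^ 2 * (a / m)))"
    using pr a_pos m edge by (intro mult_right_mono sum_mono mult_left_mono choose_one_weight) auto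
  also have "\<dots> = (\<Sum>e\<in>E. pr ^ card e) * (r * a * (real (2 * r) * a * (real (3 * r) ^ 2 * (a / m))))"
    by (simp only: sum_distrib_right mult.assoc)
  also have "\<dots> \<le> a * m * (r * a * (real (2 * r) * a * (real (3 * r) ^ 2 * (a / m))))"
    using edge_weight a_pos m by (intro mult_right_mono) auto
  also have "\<dots> = 18 * r ^ 4 * a ^ 4" using m by (simp add: power2_eq_square power4_eq_xxxx)
  finally show ?thesis .
qed

lemma expect_contains: "S \<subseteq> V \<Longrightarrow> expect (\<lambda>X. of_bool (S \<subseteq> X)) = pr ^ card S"
  using bexp_subset[OF V] by simp

text \<open>The deletion method. The second assumption limits the expected loss from vertices of
  large degree to \<open>m / 4\<close>, the third that from all short cycles together to
  \<open>m / 4\<close>.\<close>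

lemma uncrowded_sample:
  fixes D :: real
  assumes D: "1 \<le> D" "4 * r * a \<le> D" "4 * (2 ^ r + 4 * r ^ 3 + 18 * r ^ 4) * D ^ 4 \<le> m"
  obtains A where "A \<subseteq> V" "m / 2 \<le> card A" "short_cycle_free {e \<in> E. e \<subseteq> A}"
    "\<And>u. u \<in> A \<Longrightarrow> real (card {e \<in> {e \<in> E. e \<subseteq> A}. u \<in> e}) \<le> D"
proof -
  define U2 :: "'a set \<times> 'a set \<Rightarrow> 'a set" where "U2 = (\<lambda>(e, f). e \<union> f)"
  define U3 :: "'a set \<times> 'a set \<times> 'a set \<Rightarrow> 'a set" where "U3 = (\<lambda>(e, f, g). e \<union> f \<union> g)"
  define U4 :: "'a set \<times> 'a set \<times> 'a set \<times> 'a set \<Rightarrow> 'a set"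
    where "U4 = (\<lambda>(e, f, g, h). e \<union> f \<union> g \<union> h)"
  define \<Phi> :: "'a set \<Rightarrow> real" where "\<Phi> X = (\<Sum>v\<in>V. of_bool ({v} \<subseteq> X)) - r / D * (\<Sum>e\<in>E. of_bool (e \<subseteq> X))
    - (\<Sum>t\<in>cycles2. of_bool (U2 t \<subseteq> X)) - (\<Sum>t\<in>cycles3. of_bool (U3 t \<subseteq> X))
    - (\<Sum>t\<in>cycles4. of_bool (U4 t \<subseteq> X))" for X
  have sub: "\<And>t. t \<in> cycles2 \<Longrightarrow> U2 t \<subseteq> V" "\<And>t. t \<in> cycles3 \<Longrightarrow> U3 t \<subseteq> V"
    "\<And>t. t \<in> cycles4 \<Longrightarrow> U4 t \<subseteq> V"
    using edge unfolding cycles2_def cycles3_def cycles4_def U2_def U3_def U4_def by auto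
  have a: "a \<le> D"
  proof -
    have "1 * a \<le> 4 * r * a" using a_pos r by (intro mult_right_mono) auto
    then show ?thesis using D(2) by simp
  qed
  have aD: "a ^ k \<le> D ^ 4" if "k \<le> 4" for k
  proof -
    have "a ^ k \<le> D ^ k" using a a_pos by (intro power_mono) auto
    also have "\<dots> \<le> D ^ 4" using D(1) that by (rule power_increasing[rotated])
    finally show ?thesis .
  qed
  have single: "expect (\<lambda>X. of_bool (v \<in> X)) = pr" if "v \<in> V" for v
    using expect_contains[of "{v}"] that by simp
  have "expect \<Phi> = (\<Sum>v\<in>V. pr) - r / D * (\<Sum>e\<in>E. pr ^ card e) - (\<Sum>t\<in>cycles2. pr ^ card (U2 t))
      - (\<Sum>t\<in>cycles3. pr ^ card (U3 t)) - (\<Sum>t\<in>cycles4. pr ^ card (U4 t))"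
    unfolding \<Phi>_def bexp_diff bexp_cmult bexp_sum
    using edge sub by (intro arg_cong2[where f = "(-)"] arg_cong2[where f = "(*)"] sum.cong refl)
      (auto simp: expect_contains single)
  moreover have "(\<Sum>v\<in>V. pr) = m" using pr(3) by simp
  moreover have "r / D * (\<Sum>e\<in>E. pr ^ card e) \<le> m / 4"
  proof -
    have "r / D * (\<Sum>e\<in>E. pr ^ card e) \<le> r / D * (a * m)"
      using edge_weight D(1) by (intro mult_left_mono) auto
    also have "\<dots> = (4 * r * a) / D * m / 4" by simp
    also have "\<dots> \<le> 1 * m / 4" using D m by (intro divide_right_mono mult_right_mono) auto
    finally show ?thesis by simp
  qed
  moreover have "(\<Sum>t\<in>cycles2. pr ^ card (U2 t)) \<le> 2 ^ r * D ^ 4"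
  proof -
    have "(\<Sum>t\<in>cycles2. pr ^ card (U2 t)) \<le> 2 ^ r * a ^ 2"
      using cycles2_weight by (simp add: U2_def split_def)
    also have "\<dots> \<le> 2 ^ r * D ^ 4" using aD by (intro mult_left_mono) auto
    finally show ?thesis .
  qed
  moreover have "(\<Sum>t\<in>cycles3. pr ^ card (U3 t)) \<le> 4 * r ^ 3 * D ^ 4"
  proof -
    have "(\<Sum>t\<in>cycles3. pr ^ card (U3 t)) \<le> 4 * r ^ 3 * a ^ 3"
      using cycles3_weight by (simp add: U3_def split_def)
    also have "\<dots> \<le> 4 * r ^ 3 * D ^ 4" using aD by (intro mult_left_mono) auto
    finally show ?thesis .
  qed
  moreover have "(\<Sum>t\<in>cycles4. pr ^ card (U4 t)) \<le> 18 * r ^ 4 * D ^ 4"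
  proof -
    have "(\<Sum>t\<in>cycles4. pr ^ card (U4 t)) \<le> 18 * r ^ 4 * a ^ 4"
      using cycles4_weight by (simp add: U4_def split_def)
    also have "\<dots> \<le> 18 * r ^ 4 * D ^ 4" using aD by (intro mult_left_mono) auto
    finally show ?thesis .
  qed
  moreover have "2 ^ r * D ^ 4 + 4 * r ^ 3 * D ^ 4 + 18 * r ^ 4 * D ^ 4 \<le> m / 4"
    using D(3) by (simp add: algebra_simps)
  ultimately have "m / 2 \<le> expect \<Phi>" by linarith
  moreover obtain X where X: "X \<subseteq> V" "expect \<Phi> \<le> \<Phi> X"
    using bexp_attained[OF V, of "\<lambda>_. pr" \<Phi>] pr by force
  ultimately have \<Phi>X: "m / 2 \<le> \<Phi> X" by linarith
  define H where "H = {e \<in> E. e \<subseteq> X}"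
  define C2 where "C2 = {t \<in> cycles2. U2 t \<subseteq> X}"
  define C3 where "C3 = {t \<in> cycles3. U3 t \<subseteq> X}"
  define C4 where "C4 = {t \<in> cycles4. U4 t \<subseteq> X}"
  \<comment> \<open>One vertex of the first edge destroys the cycle.\<close>
  define R where "R = (\<lambda>e. SOME v. v \<in> e) ` (fst ` C2 \<union> fst ` C3 \<union> fst ` C4)"
  define B where "B = {v \<in> X. D < real (card {e \<in> H. v \<in> e})}"
  define A where "A = X - B - R"
  have fX: "finite X" using X(1) V finite_subset by blast
  have fH: "finite H" using finite_E unfolding H_def by simp
  have fC: "finite C2" "finite C3" "finite C4"
    using finite_cycles unfolding C2_def C3_def C4_def by auto
  have count: "(\<Sum>t\<in>S. of_bool (P t)) = real (card {t \<in> S. P t})" if "finite S" for S :: "'b set" and P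
    using that by (simp add: of_bool_def sum.If_cases Int_def)
  have "(\<Sum>v\<in>V. of_bool ({v} \<subseteq> X)) = real (card X)"
  proof -
    have "{v \<in> V. {v} \<subseteq> X} = X" using X(1) by auto
    then show ?thesis using count[OF V, of "\<lambda>v. {v} \<subseteq> X"] by simp
  qed
  then have \<Phi>_eq: "\<Phi> X = card X - r / D * card H - card C2 - card C3 - card C4"
    unfolding \<Phi>_def H_def C2_def C3_def C4_def
    by (simp only: count[OF finite_E] count[OF finite_cycles(1)] count[OF finite_cycles(2)] count[OF finite_cycles(3)])
  have "card R \<le> card (fst ` C2 \<union> fst ` C3 \<union> fst ` C4)"
    unfolding R_def using fC by (intro card_image_le) auto
  also have "\<dots> \<le> card (fst ` C2) + card (fst ` C3) + card (fst ` C4)"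
    using card_Un_le[of "fst ` C2 \<union> fst ` C3" "fst ` C4"] card_Un_le[of "fst ` C2" "fst ` C3"] by linarith
  also have "\<dots> \<le> card C2 + card C3 + card C4"
    using fC by (intro add_mono card_image_le)
  finally have R: "card R \<le> card C2 + card C3 + card C4" .
  \<comment> \<open>Double counting of incidences explains the weight \<open>r / D\<close> in
    \<open>\<Phi>\<close>.\<close>
  have "D * card B = (\<Sum>v\<in>B. D)" by simp
  also have "\<dots> \<le> (\<Sum>v\<in>B. real (card {e \<in> H. v \<in> e}))"
    unfolding B_def by (intro sum_mono) auto
  also have "\<dots> \<le> (\<Sum>v\<in>X. real (card {e \<in> H. v \<in> e}))"
    using fX unfolding B_def by (intro sum_mono2) auto
  also have "\<dots> = (\<Sum>v\<in>X. \<Sum>e\<in>H. of_bool (v \<in> e))" using count[OF fH] by simp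
  also have "\<dots> = (\<Sum>e\<in>H. \<Sum>v\<in>X. of_bool (v \<in> e))" by (rule sum.swap)
  also have "\<dots> = (\<Sum>e\<in>H. real r)"
  proof (rule sum.cong[OF refl])
    fix e assume "e \<in> H"
    then have "{v \<in> X. v \<in> e} = e" "card e = r" using edge unfolding H_def by auto
    then show "(\<Sum>v\<in>X. of_bool (v \<in> e)) = real r" using count[OF fX, of "\<lambda>v. v \<in> e"] by simp
  qed
  also have "\<dots> = r * card H" by simp
  finally have B: "card B \<le> r / D * card H" using D(1) by (simp add: field_simps)
  have size: "m / 2 \<le> card A"
  proof -
    have "card X \<le> card (A \<union> (B \<union> R))"
      using fX fC by (intro card_mono) (auto simp: A_def B_def R_def)
    also have "\<dots> \<le> card A + (card B + card R)"
      using card_Un_le[of A "B \<union> R"] card_Un_le[of B R] by linarith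
    finally have "real (card X) \<le> card A + (card B + card R)" by (metis of_nat_le_iff of_nat_add)
    then show ?thesis using \<Phi>X R B unfolding \<Phi>_eq by linarith
  qed
  have notin: "\<not> e \<subseteq> A" if "e \<in> fst ` C2 \<union> fst ` C3 \<union> fst ` C4" "e \<in> E" for e
  proof -
    have "e \<noteq> {}" using edge[OF that(2)] r by auto
    then have "(SOME v. v \<in> e) \<in> e" by (simp add: some_in_eq)
    moreover have "(SOME v. v \<in> e) \<in> R" using that(1) unfolding R_def by blast
    ultimately show ?thesis unfolding A_def by blast
  qed
  have AX: "A \<subseteq> X" unfolding A_def by auto
  show thesis
  proof (rule that[of A])
    show "A \<subseteq> V" using AX X(1) by blast
    show "m / 2 \<le> card A" by (rule size)
    show "short_cycle_free {e \<in> E. e \<subseteq> A}"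
    proof (rule short_cycle_freeI)
      fix e f assume e: "e \<in> {e \<in> E. e \<subseteq> A}" and f: "f \<in> {e \<in> E. e \<subseteq> A}" "f \<noteq> e"
      show "\<not> 2 \<le> card (f \<inter> e)"
      proof
        assume "2 \<le> card (f \<inter> e)"
        then have "(e, f) \<in> C2" using e f AX unfolding C2_def cycles2_def U2_def by auto
        then have "e \<in> fst ` C2" by force
        then show False using notin e by blast
      qed
    next
      fix e f g assume e: "e \<in> {e \<in> E. e \<subseteq> A}" and f: "f \<in> {e \<in> E. e \<subseteq> A}" "g \<in> {e \<in> E. e \<subseteq> A}"
        "card (f \<inter> e) = 1"
      show "card (g \<inter> (e \<union> f)) \<noteq> 2"
      proof
        assume "card (g \<inter> (e \<union> f)) = 2"
        then have "(e, f, g) \<in> C3" using e f AX unfolding C3_def cycles3_def U3_def by auto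
        then have "e \<in> fst ` C3" by force
        then show False using notin e by blast
      qed
    next
      fix e f g h assume e: "e \<in> {e \<in> E. e \<subseteq> A}" and f: "f \<in> {e \<in> E. e \<subseteq> A}" "g \<in> {e \<in> E. e \<subseteq> A}"
        "h \<in> {e \<in> E. e \<subseteq> A}" "card (f \<inter> e) = 1" "card (g \<inter> (e \<union> f)) = 1"
      show "card (h \<inter> (e \<union> f \<union> g)) \<noteq> 2"
      proof
        assume "card (h \<inter> (e \<union> f \<union> g)) = 2"
        then have "(e, f, g, h) \<in> C4" using e f AX unfolding C4_def cycles4_def U4_def by auto
        then have "e \<in> fst ` C4" by force
        then show False using notin e by blast
      qed
    qed (use edge in auto)
    fix u assume u: "u \<in> A"
    have "card {e \<in> {e \<in> E. e \<subseteq> A}. u \<in> e} \<le> card {e \<in> H. u \<in> e}"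
      using AX fH by (intro card_mono) (auto simp: H_def intro: finite_subset[OF _ finite_E])
    moreover have "real (card {e \<in> H. u \<in> e}) \<le> D" using u unfolding A_def B_def by auto
    ultimately show "real (card {e \<in> {e \<in> E. e \<subseteq> A}. u \<in> e}) \<le> D" by linarith
  qed
qed

end

section \<open>The main theorem\<close>

lemma card_le_independence_number:
  assumes "finite V" "independent_set V E J"
  shows "card J \<le> independence_number V E"
proof -
  have "finite {I. independent_set V E I}"
    using assms(1) by (rule finite_subset[rotated, OF finite_Pow_iff[THEN iffD2]]) (auto simp: independent_set_def)
  then show ?thesis using assms(2) unfolding independence_number_def by (intro Max_ge) auto
qed

lemma codegree_le_max_codegree:
  assumes "finite V" "S \<in> nsets V (r - 1)"
  shows "codegree E S \<le> max_codegree r V E"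
  unfolding max_codegree_def using assms by (intro Max_ge) (auto simp: finite_imp_finite_nsets)

theorem theorem2p2:
  fixes r :: nat
  assumes "r \<ge> 3"
  shows "\<exists>c\<^sub>0>0. \<exists>\<delta>\<^sub>0>0. \<forall>\<delta>::real. 0 < \<delta> \<and> \<delta> \<le> \<delta>\<^sub>0 \<longrightarrow>
    (\<forall>\<^sub>F n in sequentially. \<forall>(V :: 'a set) E.
      r_graph r V E \<and> card V = n \<and> real (max_codegree r V E) \<le> \<delta> * real n \<longrightarrow>
      real (independence_number V E) \<ge>
        c\<^sub>0 * (1 / \<delta> * ln (1 / \<delta>)) powr (1 / (real r - 1)))"
proof -
  define \<rho> where "\<rho> = real r - 1"
  \<comment> \<open>With \<open>T \<le> L / K\<close>, this makes \<open>D ^ 4\<close> at most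
    \<open>exp (L / (2 * \<rho>))\<close>, while \<open>m\<close> is at least of order
    \<open>exp (L / \<rho>)\<close>.\<close>
  define K where "K = 128 * \<rho> ^ 3"
  define b where "b = 2 ^ r + 4 * real r ^ 3 + 18 * real r ^ 4"
  \<comment> \<open>The first term makes \<open>16 * r * b\<close> at most
    \<open>exp (L / (2 * \<rho>))\<close> as well; the second makes \<open>T\<close> at least
    \<open>r\<close>.\<close>
  define L\<^sub>0 where "L\<^sub>0 = 2 * \<rho> * ln (16 * r * b) + K * (r + 1)"
  define \<kappa> where "\<kappa> = exp (- (4 * \<rho>))"
  define c where "c = \<kappa> / 8 * (1 / (8 * r * K)) powr (1 / \<rho>)"
  have \<rho>: "2 \<le> \<rho>" using assms unfolding \<rho>_def by simp
  have K: "1 \<le> K" using \<rho> one_le_power[of \<rho> 3] unfolding K_def by linarith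
  have b: "1 \<le> b" unfolding b_def using one_le_power[of "2 :: real" r] by (simp add: add_increasing2)
  have rb: "1 \<le> 16 * r * b"
  proof -
    have "1 * 1 \<le> (16 * real r) * b" using assms b by (intro mult_mono) auto
    then show ?thesis by simp
  qed
  have c: "0 < c" unfolding c_def \<kappa>_def using K assms by simp
  have main: "c * (1 / \<delta> * ln (1 / \<delta>)) powr (1 / (real r - 1)) \<le> real (independence_number V E)"
    if \<delta>: "0 < \<delta>" "\<delta> \<le> exp (- L\<^sub>0)"
      and T: "T = nat \<lfloor>ln (1 / \<delta>) / K\<rfloor>"
      and D: "D = exp (16 * \<rho> ^ 2 * T)"
      and m: "m = (D / (4 * r * \<delta>)) powr (1 / \<rho>)"
      and V: "m \<le> card V" "r_graph r V E" "real (max_codegree r V E) \<le> \<delta> * real (card V)"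
    for \<delta> D m :: real and T :: nat and V :: "'a set" and E
  proof -
    define L where "L = ln (1 / \<delta>)"
    have "ln \<delta> \<le> ln (exp (- L\<^sub>0))" using \<delta> by (subst ln_le_cancel_iff) auto
    then have "ln \<delta> \<le> - L\<^sub>0" by simp
    then have L: "L\<^sub>0 \<le> L" "exp L = 1 / \<delta>"
      using \<delta>(1) unfolding L_def by (simp add: ln_div, subst exp_ln) auto
    have "0 \<le> 2 * \<rho> * ln (16 * r * b)" using rb \<rho> by (intro mult_nonneg_nonneg ln_ge_zero) auto
    then have LK: "K * (r + 1) \<le> L" using L unfolding L\<^sub>0_def by linarith
    have "0 \<le> K * (r + 1)" using K by simp
    then have Lb: "2 * \<rho> * ln (16 * r * b) \<le> L" and L0: "0 \<le> L" using L LK unfolding L\<^sub>0_def by linarith+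
    have rL: "real r + 1 \<le> L / K" using LK K by (simp add: field_simps)
    have "real T = real_of_int \<lfloor>L / K\<rfloor>" unfolding T L_def[symmetric] using L0 K by (intro of_nat_nat) simp
    then have T1: "T \<le> L / K" "L / K - 1 \<le> T" by linarith+
    have "real r \<le> T" using T1 rL by linarith
    then have rT: "r \<le> T" by simp
    interpret S: schedule r T using assms rT by unfold_locales
    have S\<rho>: "real S.\<rho> = \<rho>" using S.\<rho>(3) unfolding \<rho>_def .
    have SD: "S.D = D" unfolding S.D_def D S\<rho> ..
    have S\<kappa>: "S.\<kappa> = \<kappa>" unfolding S.\<kappa>_def \<kappa>_def S\<rho> ..
    have D1: "1 \<le> D" unfolding D by simp
    \<comment> \<open>The choice of \<open>m\<close> gives \<open>4 * r * H.a = D\<close>, the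
      degree condition of \<open>uncrowded_sample\<close> with equality.\<close>
    have m\<rho>: "m ^ (r - 1) = D / (4 * r * \<delta>)"
    proof -
      have pos: "0 < D / (4 * r * \<delta>)" using D1 \<delta>(1) assms by simp
      have "0 < m" unfolding m using pos by (metis powr_gt_zero less_irrefl)
      then have "m ^ (r - 1) = m powr real (r - 1)" by (rule powr_realpow[symmetric])
      also have "real (r - 1) = \<rho>" using assms unfolding \<rho>_def by simp
      also have "m powr \<rho> = D / (4 * r * \<delta>)" 
      proof -
        have "1 / \<rho> * \<rho> = 1" using \<rho> by simp
        then show ?thesis unfolding m powr_powr using pos by (simp only: powr_one less_imp_le)
      qed
      finally show ?thesis .
    qed
    have Dm: "4 * b * D ^ 4 \<le> m"
    proof -
      have "D ^ 4 = exp (4 * (16 * \<rho> ^ 2 * T))" unfolding D using exp_of_nat_mult[of 4 "16 * \<rho> ^ 2 * T"] by simp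
      also have "\<dots> \<le> exp (4 * (16 * \<rho> ^ 2 * (L / K)))"
        unfolding exp_le_cancel_iff using T1(1) by (intro mult_left_mono) auto
      also have "4 * (16 * \<rho> ^ 2 * (L / K)) = L / (2 * \<rho>)"
        unfolding K_def using \<rho> by (simp add: field_simps power2_eq_square power3_eq_cube)
      finally have D4: "D ^ 4 \<le> exp (L / (2 * \<rho>))" .
      have "ln (16 * r * b) \<le> L / (2 * \<rho>)" using Lb \<rho> by (simp add: field_simps)
      then have "exp (ln (16 * r * b)) \<le> exp (L / (2 * \<rho>))" by (simp only: exp_le_cancel_iff)
      moreover have "exp (ln (16 * r * b)) = 16 * r * b" using rb by (intro exp_ln) linarith
      ultimately have b4: "16 * r * b \<le> exp (L / (2 * \<rho>))" by linarith
      have "16 * r * b * D ^ 4 \<le> exp (L / (2 * \<rho>)) * exp (L / (2 * \<rho>))"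
        using D4 b4 D1 by (intro mult_mono) auto
      also have "\<dots> = exp (L / (2 * \<rho>) + L / (2 * \<rho>))" by (rule mult_exp_exp)
      also have "L / (2 * \<rho>) + L / (2 * \<rho>) = L / \<rho>" using \<rho> by (simp add: field_simps)
      finally have 1: "4 * b * D ^ 4 * (4 * r) \<le> exp (L / \<rho>)" by (simp add: mult_ac)
      have "exp (L / \<rho>) = exp L powr (1 / \<rho>)" by (simp add: powr_def)
      also have "\<dots> = (1 / (4 * r * \<delta>)) powr (1 / \<rho>) * (4 * r) powr (1 / \<rho>)"
        unfolding L(2) using \<delta> assms by (subst powr_mult[symmetric]) auto
      also have "\<dots> \<le> m * (4 * r)"
      proof (rule mult_mono)
        show "(1 / (4 * r * \<delta>)) powr (1 / \<rho>) \<le> m"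
          unfolding m using \<delta> assms D1 \<rho> by (intro powr_mono2 divide_right_mono) auto
        have "(4 * real r) powr (1 / \<rho>) \<le> (4 * real r) powr 1"
          using \<rho> assms by (intro powr_mono) auto
        then show "real (4 * r) powr (1 / \<rho>) \<le> real (4 * r)" by simp
      qed (auto simp: m)
      finally have "exp (L / \<rho>) \<le> m * (4 * r)" .
      then have "4 * b * D ^ 4 * (4 * r) \<le> m * (4 * r)" using 1 by linarith
      then show ?thesis using assms by simp
    qed
    have m1: "1 \<le> m"
    proof -
      have "1 * 1 \<le> (4 * b) * D ^ 4" using b D1 by (intro mult_mono one_le_power) auto
      then show ?thesis using Dm by linarith
    qed
    have fV: "finite V" and EV: "E \<subseteq> nsets V r" using V(2) unfolding r_graph_def by auto
    interpret H: dense_hypergraph V E r \<delta> m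
    proof
      show "real (codegree E S) \<le> \<delta> * real (card V)" if "S \<in> nsets V (r - 1)" for S
        using codegree_le_max_codegree[OF fV that, of E] V(3) by linarith
    qed (use fV EV assms \<delta> m1 V(1) in auto)
    have a: "4 * r * H.a = D" unfolding H.a_def m\<rho> using \<delta> assms by simp
    obtain A where A: "A \<subseteq> V" "m / 2 \<le> card A" "short_cycle_free {e \<in> E. e \<subseteq> A}"
      "\<And>u. u \<in> A \<Longrightarrow> real (card {e \<in> {e \<in> E. e \<subseteq> A}. u \<in> e}) \<le> D"
      using H.uncrowded_sample[of D] D1 a Dm unfolding b_def by auto
    have "\<exists>J\<subseteq>A. (\<forall>f\<in>{e \<in> E. e \<subseteq> A}. \<not> f \<subseteq> J) \<and> card A * (S.\<kappa> / 4 * (T / S.D) powr (1 / S.\<rho>)) \<le> card J"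
    proof (rule S.uncrowded_independent[OF _ _ A(3)])
      show "finite A" using A(1) fV finite_subset by blast
    qed (use A(4) H.edge in \<open>auto simp: SD\<close>)
    then obtain J where J: "J \<subseteq> A" "\<And>f. f \<in> E \<Longrightarrow> f \<subseteq> A \<Longrightarrow> \<not> f \<subseteq> J"
      "card A * (\<kappa> / 4 * (T / D) powr (1 / \<rho>)) \<le> card J"
      unfolding S\<rho> SD S\<kappa> by auto
    have "independent_set V E J"
      using J(1,2) A(1) unfolding independent_set_def by blast
    then have "card J \<le> independence_number V E" by (rule card_le_independence_number[OF fV])
    then have "real (card J) \<le> real (independence_number V E)" by simp
    moreover have "c * (1 / \<delta> * L) powr (1 / \<rho>) \<le> m / 2 * (\<kappa> / 4 * (T / D) powr (1 / \<rho>))"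
    proof -
      have "c * (1 / \<delta> * L) powr (1 / \<rho>) = \<kappa> / 8 * (1 / (8 * r * K) * (1 / \<delta> * L)) powr (1 / \<rho>)"
        unfolding c_def using L0 \<delta> K by (subst powr_mult) auto
      \<comment> \<open>The factor \<open>D\<close> cancels and leaves
        \<open>T / (4 * r * \<delta>)\<close>, where \<open>T \<ge> L / (2 * K)\<close>: the
        logarithm is the number of rounds.\<close>
      also have "\<dots> \<le> \<kappa> / 8 * (D / (4 * r * \<delta>) * (T / D)) powr (1 / \<rho>)"
      proof (intro mult_left_mono powr_mono2)
        have "L / (2 * K) = L / K / 2" by simp
        then have "L / (2 * K) \<le> T" using T1 rL assms by linarith
        then have "L / (2 * K) / (4 * r * \<delta>) \<le> T / (4 * r * \<delta>)" using \<delta> by (intro divide_right_mono) auto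
        then show "1 / (8 * r * K) * (1 / \<delta> * L) \<le> D / (4 * r * \<delta>) * (T / D)"
          using D1 by (simp add: mult_ac)
      qed (use \<rho> L0 \<delta> K in \<open>auto simp: \<kappa>_def\<close>)
      also have "\<dots> = \<kappa> / 8 * (m * (T / D) powr (1 / \<rho>))"
        unfolding m using D1 \<delta> by (subst powr_mult) auto
      also have "\<dots> = m / 2 * (\<kappa> / 4 * (T / D) powr (1 / \<rho>))" by simp
      finally show ?thesis .
    qed
    moreover have "m / 2 * (\<kappa> / 4 * (T / D) powr (1 / \<rho>)) \<le> card A * (\<kappa> / 4 * (T / D) powr (1 / \<rho>))"
      using A(2) unfolding \<kappa>_def by (intro mult_right_mono) auto
    ultimately show ?thesis using J(3) unfolding \<rho>_def[symmetric] L_def by linarith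
  qed
  show ?thesis
  proof (rule exI[of _ c], rule conjI[OF c], rule exI[of _ "exp (- L\<^sub>0)"], intro conjI allI impI)
    fix \<delta> :: real assume \<delta>: "0 < \<delta> \<and> \<delta> \<le> exp (- L\<^sub>0)"
    \<comment> \<open>This threshold depends only on \<open>r\<close> and \<open>\<delta>\<close>,
      so every large \<open>n\<close> exceeds it.\<close>
    let ?m = "(exp (16 * \<rho> ^ 2 * nat \<lfloor>ln (1 / \<delta>) / K\<rfloor>) / (4 * r * \<delta>)) powr (1 / \<rho>)"
    have "\<forall>\<^sub>F n in sequentially. ?m \<le> real n"
      by (rule eventually_sequentiallyI[of "nat \<lceil>?m\<rceil>"]) linarith
    then show "\<forall>\<^sub>F n in sequentially. \<forall>(V :: 'a set) E.
      r_graph r V E \<and> card V = n \<and> real (max_codegree r V E) \<le> \<delta> * real n \<longrightarrow>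
      real (independence_number V E) \<ge> c * (1 / \<delta> * ln (1 / \<delta>)) powr (1 / (real r - 1))"
    proof (rule eventually_mono, intro allI impI)
      fix n and V :: "'a set" and E
      assume "?m \<le> real n"
        and "r_graph r V E \<and> card V = n \<and> real (max_codegree r V E) \<le> \<delta> * real n"
      then show "c * (1 / \<delta> * ln (1 / \<delta>)) powr (1 / (real r - 1)) \<le> real (independence_number V E)"
        using \<delta> by (intro main[OF _ _ refl refl refl]) auto
    qed
  qed simp
qed

end
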